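(* Let $\gamma$ be the Gauss measure on $\mathbb{R}^n$ and suppose that $\mathcal{T}$ is a bounded linear operator on $L^2(\gamma)$ with kernel $k$ (with respect to $\gamma$). The following hold: (i) if $\mathcal{T}$ is bounded from $\mathfrak{h}^1(\gamma)$ to $L^1(\gamma)$ and $k$ satisfies the local Hörmander type condition $$\sup_{B}\ \sup_{y,y'\in B}\int_{(2B)^c}|k(x,y)-k(x,y')|\,d\gamma(x)<\infty,$$ where the outer supremum is over all admissible balls $B$, then $$I_\infty:=\sup_{y\in\mathbb{R}^n}\int_{(2B_y)^c}|k(x,y)|\,d\gamma(x)<\infty,$$ where, for every $y\in\mathbb{R}^n$, $B_y$ denotes the ball with centre $y$ and radius $\min(1,1/|y|)$; (ii) if $\mathcal{T}$ is bounded from $H^1(\gamma)$ to $L^1(\gamma)$ and $k$ satisfies $I_\infty<\infty$, then $\mathcal{T}$ is bounded from $\mathfrak{h}^1(\gamma)$ to $L^1(\gamma)$.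
   Context: $\gamma$ is the probability measure on $\mathbb{R}^n$ with density $x\mapsto \pi^{-n/2}e^{-|x|^2}$ with respect to Lebesgue measure. Balls are Euclidean; $c_B,r_B$ denote the centre and radius of a ball $B$, and $2B$ is the ball with the same centre and twice the radius. $\|\cdot\|_2$ is the norm of $L^2(\gamma)$. A ball $B$ is admissible if $r_B\le \min(1,1/|c_B|)$ (with $1/0=\infty$). Kernel: a function $k$ on $\mathbb{R}^n\times\mathbb{R}^n$, locally integrable off the diagonal, is the kernel of $\mathcal{T}$ if for every bounded function $f$ with compact support $\mathcal{T}f(x)=\int k(x,y)f(y)\,d\gamma(y)$ for all $x\notin\operatorname{supp} f$. An $H^1(\gamma)$-atom is either the constant function $1$ or a function $a\in L^1(\gamma)$ supported in an admissible ball $B$ with $\|a\|_2\le \gamma(B)^{-1/2}$ and $\int a\,d\gamma=0$. The space $H^1(\gamma)$ is the set of all $f\in L^1(\gamma)$ of the form $f=\sum_j\lambda_j a_j$ with $a_j$ $H^1(\gamma)$-atoms and $\sum_j|\lambda_j|<\infty$, normed by the infimum of $\sum_j|\lambda_j|$ over all such representations. A global atom is a function $a\in L^2(\gamma)$ with support contained in a ball $B$ of radius exactly $\min(1,1/|c_B|)$ such that $\|a\|_2\le\gamma(B)^{-1/2}$ (no cancellation required). An $\mathfrak{h}^1(\gamma)$-atom is either an $H^1(\gamma)$-atom or a global atom. The space $\mathfrak{h}^1(\gamma)$ is the set of all $f=\sum_j\lambda_j a_j$ with $a_j$ $\mathfrak{h}^1(\gamma)$-atoms and $\sum_j|\lambda_j|<\infty$,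 normed by the infimum of $\sum_j|\lambda_j|$ over all such decompositions. "$\mathcal{T}$ is bounded from $H^1(\gamma)$ (resp. $\mathfrak{h}^1(\gamma)$) to $L^1(\gamma)$" means that $\mathcal{T}$, which is defined on finite linear combinations of the corresponding atoms (these lie in $L^2(\gamma)$), extends to a bounded linear operator from that space to $L^1(\gamma)$. *)

theory Defs
  imports "HOL-Analysis.Analysis"
begin

(* Functions are complex-valued and Borel measurable. Elements of L^1 and L^2 are represented by
   functions; identities between them are stated almost everywhere. *)

definition gauss_measure :: "(real^'n) measure" where
  "gauss_measure =
     density lborel (\<lambda>x. ennreal (pi powr (- real CARD('n) / 2) * exp (- (norm x)\<^sup>2)))"

definition L2 :: "(real^'n \<Rightarrow> complex) set" where
  "L2 = {f. f \<in> borel_measurable gauss_measure \<and>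
            integrable gauss_measure (\<lambda>x. (cmod (f x))\<^sup>2)}"

definition L2_norm :: "(real^'n \<Rightarrow> complex) \<Rightarrow> real" where
  "L2_norm f = sqrt (\<integral>x. (cmod (f x))\<^sup>2 \<partial>gauss_measure)"

definition L1 :: "(real^'n \<Rightarrow> complex) set" where
  "L1 = {f. integrable gauss_measure f}"

definition L1_norm :: "(real^'n \<Rightarrow> complex) \<Rightarrow> real" where
  "L1_norm f = (\<integral>x. cmod (f x) \<partial>gauss_measure)"

definition bounded_linear_operator_on_L2 ::
  "((real^'n \<Rightarrow> complex) \<Rightarrow> (real^'n \<Rightarrow> complex)) \<Rightarrow> bool" where
  "bounded_linear_operator_on_L2 T \<longleftrightarrow>
     (\<forall>f\<in>L2. T f \<in> L2) \<and>
     (\<forall>f\<in>L2. \<forall>g\<in>L2. \<forall>\<alpha> \<beta>. AE x in gauss_measure.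
        T (\<lambda>z. \<alpha> * f z + \<beta> * g z) x = \<alpha> * T f x + \<beta> * T g x) \<and>
     (\<exists>C. \<forall>f\<in>L2. L2_norm (T f) \<le> C * L2_norm f)"

definition support :: "(real^'n \<Rightarrow> complex) \<Rightarrow> (real^'n) set" where
  "support f = closure {x. f x \<noteq> 0}"

definition locally_integrable_off_diagonal ::
  "(real^'n \<Rightarrow> real^'n \<Rightarrow> complex) \<Rightarrow> bool" where
  "locally_integrable_off_diagonal k \<longleftrightarrow>
     (\<forall>K. compact K \<and> K \<subseteq> {(x, y). x \<noteq> y} \<longrightarrow>
        set_integrable (gauss_measure \<Otimes>\<^sub>M gauss_measure) K (\<lambda>(x, y). k x y))"

(* T f is only defined almost everywhere, so the kernel identity is required for almost every x
   outside the support of f; there the integral converges absolutely for almost every x by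
   local integrability of k. *)
definition is_kernel_of ::
  "(real^'n \<Rightarrow> real^'n \<Rightarrow> complex) \<Rightarrow>
   ((real^'n \<Rightarrow> complex) \<Rightarrow> (real^'n \<Rightarrow> complex)) \<Rightarrow> bool" where
  "is_kernel_of k T \<longleftrightarrow>
     locally_integrable_off_diagonal k \<and>
     (\<forall>f. f \<in> borel_measurable borel \<and> bounded (range f) \<and> compact (support f) \<longrightarrow>
        (AE x in gauss_measure. x \<notin> support f \<longrightarrow>
           T f x = (\<integral>y. k x y * f y \<partial>gauss_measure)))"

(* Encodes min(1, 1/|c|) with 1/0 = infinity; in HOL 1/0 = 0. *)
definition max_radius :: "real^'n \<Rightarrow> real" where
  "max_radius c = (if c = 0 then 1 else min 1 (1 / norm c))"

(* Balls are open and are represented by centre and radius. *)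
definition admissible :: "real^'n \<Rightarrow> real \<Rightarrow> bool" where
  "admissible c r \<longleftrightarrow> 0 < r \<and> r \<le> max_radius c"

(* Vanishing a.e. off the open ball is the same as having essential support in the closed ball,
   since spheres are null sets. *)
definition supported_in :: "(real^'n \<Rightarrow> complex) \<Rightarrow> (real^'n) set \<Rightarrow> bool" where
  "supported_in a B \<longleftrightarrow> (AE x in gauss_measure. x \<notin> B \<longrightarrow> a x = 0)"

definition H1_atoms :: "(real^'n \<Rightarrow> complex) set" where
  "H1_atoms =
     {\<lambda>x. 1} \<union>
     {a. a \<in> L1 \<and>
         (\<exists>c r. admissible c r \<and> supported_in a (ball c r) \<and>
            a \<in> L2 \<and> L2_norm a \<le> measure gauss_measure (ball c r) powr (- 1 / 2)) \<and>
         (\<integral>x. a x \<partial>gauss_measure) = 0}"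

definition global_atoms :: "(real^'n \<Rightarrow> complex) set" where
  "global_atoms =
     {a. a \<in> L2 \<and>
         (\<exists>c. supported_in a (ball c (max_radius c)) \<and>
            L2_norm a \<le> measure gauss_measure (ball c (max_radius c)) powr (- 1 / 2))}"

definition local_h1_atoms :: "(real^'n \<Rightarrow> complex) set" where
  "local_h1_atoms = H1_atoms \<union> global_atoms"

(* f = sum_j lam_j a_j with atoms a_j in A. Atoms have L^1 norm at most 1, so the series
   converges in L^1; finite sums are obtained by letting lam vanish eventually. *)
definition atomic_decomposition ::
  "(real^'n \<Rightarrow> complex) set \<Rightarrow> (real^'n \<Rightarrow> complex) \<Rightarrow>
   (nat \<Rightarrow> complex) \<Rightarrow> (nat \<Rightarrow> real^'n \<Rightarrow> complex) \<Rightarrow> bool" where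
  "atomic_decomposition A f lam a \<longleftrightarrow>
     (\<forall>j. a j \<in> A) \<and> summable (\<lambda>j. cmod (lam j)) \<and>
     (\<lambda>N. L1_norm (\<lambda>x. f x - (\<Sum>j<N. lam j * a j x))) \<longlonglongrightarrow> 0"

definition atomic_space :: "(real^'n \<Rightarrow> complex) set \<Rightarrow> (real^'n \<Rightarrow> complex) set" where
  "atomic_space A = {f. f \<in> L1 \<and> (\<exists>lam a. atomic_decomposition A f lam a)}"

definition atomic_norm :: "(real^'n \<Rightarrow> complex) set \<Rightarrow> (real^'n \<Rightarrow> complex) \<Rightarrow> real" where
  "atomic_norm A f = Inf {(\<Sum>j. cmod (lam j)) | lam a. atomic_decomposition A f lam a}"

definition finite_combinations ::
  "(real^'n \<Rightarrow> complex) set \<Rightarrow> (real^'n \<Rightarrow> complex) set" where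
  "finite_combinations A =
     {(\<lambda>x. \<Sum>j<N. lam j * a j x) | (N::nat) lam a. \<forall>j<N. a j \<in> A}"

(* T, restricted to finite linear combinations of atoms in A, has a bounded linear extension S
   from the atomic space generated by A to L^1. *)
definition bounded_to_L1 ::
  "(real^'n \<Rightarrow> complex) set \<Rightarrow>
   ((real^'n \<Rightarrow> complex) \<Rightarrow> (real^'n \<Rightarrow> complex)) \<Rightarrow> bool" where
  "bounded_to_L1 A T \<longleftrightarrow>
     (\<exists>S :: (real^'n \<Rightarrow> complex) \<Rightarrow> (real^'n \<Rightarrow> complex).
        (\<forall>f\<in>atomic_space A. S f \<in> L1) \<and>
        (\<forall>f\<in>atomic_space A. \<forall>g\<in>atomic_space A. \<forall>\<alpha> \<beta>. AE x in gauss_measure.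
           S (\<lambda>z. \<alpha> * f z + \<beta> * g z) x = \<alpha> * S f x + \<beta> * S g x) \<and>
        (\<exists>C. \<forall>f\<in>atomic_space A. L1_norm (S f) \<le> C * atomic_norm A f) \<and>
        (\<forall>f\<in>finite_combinations A. AE x in gauss_measure. S f x = T f x))"

abbreviation bounded_H1_L1 ::
  "((real^'n \<Rightarrow> complex) \<Rightarrow> (real^'n \<Rightarrow> complex)) \<Rightarrow> bool" where
  "bounded_H1_L1 \<equiv> bounded_to_L1 H1_atoms"

abbreviation bounded_local_h1_L1 ::
  "((real^'n \<Rightarrow> complex) \<Rightarrow> (real^'n \<Rightarrow> complex)) \<Rightarrow> bool" where
  "bounded_local_h1_L1 \<equiv> bounded_to_L1 local_h1_atoms"

definition local_Hormander_const :: "(real^'n \<Rightarrow> real^'n \<Rightarrow> complex) \<Rightarrow> ennreal" where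
  "local_Hormander_const k =
     (SUP (c, r) \<in> {(c, r). admissible c r}. SUP y \<in> ball c r. SUP y' \<in> ball c r.
        \<integral>\<^sup>+x\<in>- ball c (2 * r). ennreal (cmod (k x y - k x y')) \<partial>gauss_measure)"

definition I_infinity :: "(real^'n \<Rightarrow> real^'n \<Rightarrow> complex) \<Rightarrow> ennreal" where
  "I_infinity k =
     (SUP y. \<integral>\<^sup>+x\<in>- ball y (2 * max_radius y). ennreal (cmod (k x y)) \<partial>gauss_measure)"

end

theory Submission
  imports Defs "HOL-Probability.Distributions"
begin

text \<open>
  (i) The normalised indicator of the ball \<open>B = B_y\<close> is a global atom. Its image is, off \<open>2B\<close>, the mean of
  \<open>k(x, z)\<close> over \<open>z \<in> B\<close>, and by the Hoermander condition this mean differs from \<open>k(x, y)\<close> by a bounded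
  amount in \<open>L\<^sup>1(dx)\<close>.

  (ii) A global atom in \<open>B\<close> has an image bounded in \<open>L\<^sup>1\<close>: on \<open>5B\<close> by the \<open>L\<^sup>2\<close> bound and the doubling
  property of maximal admissible balls, off \<open>5B\<close> by \<open>I_\<infinity>\<close>, since \<open>5B\<close> contains \<open>2B_y\<close> for every
  \<open>y \<in> B\<close>. So the operator is uniformly bounded on all atoms, and the extension has to be
  \<open>\<Sum> \<lambda>_j a_j \<mapsto> \<Sum> \<lambda>_j T a_j\<close>. This is well defined by duality: a functional \<open>f \<mapsto> \<integral> p T f\<close> with
  \<open>p\<close> bounded is represented on \<open>L\<^sup>2\<close> by some \<open>b\<close>, whose mean oscillation is controlled by its values on
  atoms. Truncations of \<open>b\<close> are bounded functions with no larger oscillation; they annihilate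
  every vanishing atomic series, and dominated convergence transfers this to \<open>b\<close>.
\<close>

subsection \<open>Square-integrable functions over a finite measure\<close>

text \<open>A uniform bound on atoms does not by itself yield an extension: the atomic norm of a
  finite combination is an infimum over infinite decompositions, whose partial sums converge only in
  L^1, where \<open>T\<close> has no known continuity. The point to settle is therefore that an
  atomic series with sum 0 has an image series with sum 0. Pairing that image with p = cnj (sgn g),
  where g is its sum, moves \<open>T\<close> onto a fixed \<open>b\<close> in L^2, the transpose of
  \<open>T\<close> applied to p. As \<open>b\<close> may be unbounded, convergence in L^1 cannot be
  tested against it, but it can be tested against truncations of \<open>b\<close>. Metric projection
  onto a disc is nonexpansive, so the bounds on atoms survive truncation uniformly in the height.
  The constant atom 1 is supported in no admissible ball and is estimated by the L^1 norm of
  \<open>b\<close> instead. The factor 5 in (ii) is 2 * 2 + 1: if y lies in a maximal ball of radius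
  r, then B_y has radius at most 2r, so 2B_y stays within 4r of y, and y is within r of the
  centre.\<close>

definition square_integrable :: "'a measure \<Rightarrow> ('a \<Rightarrow> complex) \<Rightarrow> bool" where
  "square_integrable M f \<longleftrightarrow>
     f \<in> borel_measurable M \<and> integrable M (\<lambda>x. (cmod (f x))\<^sup>2)"

text \<open>Together with \<open>square_integrable\<close> this is the analogue of
  \<open>L2_norm\<close> and \<open>L2\<close> for an arbitrary measure, so that completeness and
  the Riesz theorem can be proved for abstract finite measures. \<open>L2_iff\<close> and
  \<open>L2_norm_eq\<close> translate back.\<close>

definition norm2 :: "'a measure \<Rightarrow> ('a \<Rightarrow> complex) \<Rightarrow> real" where
  "norm2 M f = sqrt (\<integral>x. (cmod (f x))\<^sup>2 \<partial>M)"

lemma norm2_nonneg: "0 \<le> norm2 M f"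
  by (simp add: norm2_def)

lemma norm2_power2: "(norm2 M f)\<^sup>2 = (\<integral>x. (cmod (f x))\<^sup>2 \<partial>M)"
  by (simp add: norm2_def)

lemma norm2_mono:
  assumes "square_integrable M g" "f \<in> borel_measurable M" "AE x in M. cmod (f x) \<le> cmod (g x)"
  shows "square_integrable M f" "norm2 M f \<le> norm2 M g"
proof -
  have [measurable]: "f \<in> borel_measurable M" by fact
  have le: "AE x in M. (cmod (f x))\<^sup>2 \<le> (cmod (g x))\<^sup>2"
    using assms(3) by eventually_elim (simp add: power_mono)
  have "integrable M (\<lambda>x. (cmod (f x))\<^sup>2)"
    using assms(1) le unfolding square_integrable_def
    by (intro Bochner_Integration.integrable_bound[of M "\<lambda>x. (cmod (g x))\<^sup>2" "\<lambda>x. (cmod (f x))\<^sup>2"]) auto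
  then show f: "square_integrable M f" using assms(2) by (simp add: square_integrable_def)
  show "norm2 M f \<le> norm2 M g"
    unfolding norm2_def using f assms(1) le
    by (intro real_sqrt_le_mono integral_mono_AE) (auto simp: square_integrable_def)
qed

lemma square_integrable_cmult:
  "square_integrable M f \<Longrightarrow> square_integrable M (\<lambda>x. c * f x)"
  by (auto simp: square_integrable_def norm_mult power_mult_distrib)

lemma norm2_cmult: "norm2 M (\<lambda>x. c * f x) = cmod c * norm2 M f"
  by (simp add: norm2_def norm_mult power_mult_distrib real_sqrt_mult)

lemma square_integrable_cnj: "square_integrable M f \<Longrightarrow> square_integrable M (\<lambda>x. cnj (f x))"
  by (auto simp: square_integrable_def intro!: borel_measurable_continuous_on[where f=cnj] continuous_intros)

lemma norm2_cnj: "norm2 M (\<lambda>x. cnj (f x)) = norm2 M f"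
  by (simp add: norm2_def)

lemma square_integrable_add:
  assumes "square_integrable M f" "square_integrable M g"
  shows "square_integrable M (\<lambda>x. f x + g x)"
proof -
  have [measurable]: "f \<in> borel_measurable M" "g \<in> borel_measurable M"
    using assms by (auto simp: square_integrable_def)
  have *: "(cmod (a + b))\<^sup>2 \<le> 2 * (cmod a)\<^sup>2 + 2 * (cmod b)\<^sup>2" for a b :: complex
    using power_mono[OF norm_triangle_ineq[of a b], of 2] sum_squares_bound[of "cmod a" "cmod b"]
    by (simp add: power2_sum)
  have "integrable M (\<lambda>x. (cmod (f x + g x))\<^sup>2)"
    using assms * unfolding square_integrable_def
    by (intro Bochner_Integration.integrable_bound
        [of M "\<lambda>x. 2 * (cmod (f x))\<^sup>2 + 2 * (cmod (g x))\<^sup>2" "\<lambda>x. (cmod (f x + g x))\<^sup>2"]) auto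
  then show ?thesis by (simp add: square_integrable_def)
qed

lemma square_integrable_diff:
  assumes "square_integrable M f" "square_integrable M g"
  shows "square_integrable M (\<lambda>x. f x - g x)"
  using square_integrable_add[OF assms(1) square_integrable_cmult[OF assms(2), of "-1"]] by simp

lemma square_integrable_mult:
  assumes "square_integrable M f" "square_integrable M g"
  shows "integrable M (\<lambda>x. f x * g x)"
proof -
  have [measurable]: "f \<in> borel_measurable M" "g \<in> borel_measurable M"
    using assms by (auto simp: square_integrable_def)
  have *: "cmod (a * b) \<le> (cmod a)\<^sup>2 + (cmod b)\<^sup>2" for a b :: complex
  proof -
    have "0 \<le> cmod a * cmod b" by simp
    then show ?thesis
      using sum_squares_bound[of "cmod a" "cmod b"] unfolding norm_mult mult.assoc by linarith
  qed
  show ?thesis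
    using assms * unfolding square_integrable_def
    by (intro Bochner_Integration.integrable_bound
        [of M "\<lambda>x. (cmod (f x))\<^sup>2 + (cmod (g x))\<^sup>2" "\<lambda>x. f x * g x"]) auto
qed

lemma Cauchy_Schwarz_norm2:
  assumes "square_integrable M f" "square_integrable M g"
  shows "(\<integral>x. cmod (f x * g x) \<partial>M) \<le> norm2 M f * norm2 M g"
proof -
  have [measurable]: "f \<in> borel_measurable M" "g \<in> borel_measurable M"
    using assms by (auto simp: square_integrable_def)
  define F where "F = norm2 M f"
  define G where "G = norm2 M g"
  define I where "I = (\<integral>x. cmod (f x * g x) \<partial>M)"
  have int: "integrable M (\<lambda>x. (cmod (f x))\<^sup>2)" "integrable M (\<lambda>x. (cmod (g x))\<^sup>2)"
    using assms by (auto simp: square_integrable_def)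
  have "(\<integral>\<^sup>+x. ennreal (cmod (f x)) * ennreal (cmod (g x)) \<partial>M)\<^sup>2 \<le>
        (\<integral>\<^sup>+x. ennreal (cmod (f x)) ^ 2 \<partial>M) * (\<integral>\<^sup>+x. ennreal (cmod (g x)) ^ 2 \<partial>M)"
    by (rule Cauchy_Schwarz_nn_integral) auto
  also have "(\<integral>\<^sup>+x. ennreal (cmod (f x)) ^ 2 \<partial>M) = ennreal (F\<^sup>2)"
    using int by (simp add: ennreal_power nn_integral_eq_integral norm2_power2 F_def)
  also have "(\<integral>\<^sup>+x. ennreal (cmod (g x)) ^ 2 \<partial>M) = ennreal (G\<^sup>2)"
    using int by (simp add: ennreal_power nn_integral_eq_integral norm2_power2 G_def)
  also have "(\<integral>\<^sup>+x. ennreal (cmod (f x)) * ennreal (cmod (g x)) \<partial>M) = ennreal I"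
    using integrable_norm[OF square_integrable_mult[OF assms]] unfolding I_def
    by (subst nn_integral_eq_integral[symmetric]) (auto simp: norm_mult ennreal_mult)
  finally have "ennreal (I\<^sup>2) \<le> ennreal ((F * G)\<^sup>2)"
    by (simp add: ennreal_power I_def ennreal_mult[symmetric] power_mult_distrib)
  then have "I\<^sup>2 \<le> (F * G)\<^sup>2" by simp
  then show ?thesis
    unfolding I_def F_def G_def by (rule power2_le_imp_le) (simp add: norm2_nonneg)
qed

lemma norm_integral_mult_le:
  assumes "square_integrable M f" "square_integrable M g"
  shows "cmod (\<integral>x. f x * g x \<partial>M) \<le> norm2 M f * norm2 M g"
  using integral_norm_bound[of M "\<lambda>x. f x * g x"] Cauchy_Schwarz_norm2[OF assms] by linarith

lemma (in finite_measure) square_integrable_bounded: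
  assumes "f \<in> borel_measurable M" "\<And>x. cmod (f x) \<le> C"
  shows "square_integrable M f"
proof -
  have "integrable M (\<lambda>x. (cmod (f x))\<^sup>2)"
    using assms by (intro integrable_const_bound[where B="C\<^sup>2"]) (auto intro!: power_mono)
  then show ?thesis using assms by (simp add: square_integrable_def)
qed

lemma (in finite_measure) norm2_one: "norm2 M (\<lambda>x. 1) = sqrt (measure M (space M))"
  by (simp add: norm2_def)

lemma (in finite_measure) integrable_square_integrable:
  assumes "square_integrable M f"
  shows "integrable M f"
  using square_integrable_mult[OF assms square_integrable_bounded[of "\<lambda>x. 1" 1]] by simp

lemma (in finite_measure) integral_cmod_le_norm2:
  assumes "square_integrable M f"
  shows "(\<integral>x. cmod (f x) \<partial>M) \<le> norm2 M f * sqrt (measure M (space M))"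
  using Cauchy_Schwarz_norm2[OF assms square_integrable_bounded[of "\<lambda>x. 1" 1]]
  by (simp add: norm2_one)

text \<open>The sum w of the moduli has finite integral by monotone convergence, so it is finite
  almost everywhere, and 2w dominates all remainders. This serves both the completeness of L^2 and
  the construction of the image series of an atomic series.\<close>

lemma summable_integral_norm_imp:
  fixes u :: "nat \<Rightarrow> 'a \<Rightarrow> complex"
  assumes u: "\<And>j. integrable M (u j)" and s: "summable (\<lambda>j. \<integral>x. cmod (u j x) \<partial>M)"
  shows "AE x in M. summable (\<lambda>j. cmod (u j x))"
    and "integrable M (\<lambda>x. \<Sum>j. u j x)"
    and "(\<lambda>N. \<integral>x. cmod ((\<Sum>j. u j x) - (\<Sum>j<N. u j x)) \<partial>M) \<longlonglongrightarrow> 0"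
proof -
  have [measurable]: "u j \<in> borel_measurable M" for j by (rule borel_measurable_integrable[OF u])
  have "(\<integral>\<^sup>+x. (\<Sum>j. ennreal (cmod (u j x))) \<partial>M) = (\<Sum>j. \<integral>\<^sup>+x. ennreal (cmod (u j x)) \<partial>M)"
    by (rule nn_integral_suminf) auto
  also have "\<dots> = (\<Sum>j. ennreal (\<integral>x. cmod (u j x) \<partial>M))"
    using u by (simp add: nn_integral_eq_integral)
  also have "\<dots> < \<infinity>"
    using s by (simp add: suminf_ennreal2 less_top)
  finally have fin: "(\<integral>\<^sup>+x. (\<Sum>j. ennreal (cmod (u j x))) \<partial>M) < \<infinity>" .
  then have "AE x in M. (\<Sum>j. ennreal (cmod (u j x))) \<noteq> \<infinity>"
    by (intro nn_integral_PInf_AE) auto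
  then show AE: "AE x in M. summable (\<lambda>j. cmod (u j x))"
    by eventually_elim (auto intro: summable_suminf_not_top)
  define w where "w x = (\<Sum>j. cmod (u j x))" for x
  have [measurable]: "w \<in> borel_measurable M" unfolding w_def by measurable
  have w: "integrable M w"
    unfolding w_def
    by (rule integrable_suminf[OF integrable_norm[OF u]]) (use s AE in simp_all)
  show int: "integrable M (\<lambda>x. \<Sum>j. u j x)"
    by (rule integrable_suminf[OF u AE s])
  have "(\<lambda>N. \<integral>x. cmod ((\<Sum>j. u j x) - (\<Sum>j<N. u j x)) \<partial>M) \<longlonglongrightarrow> (\<integral>x. 0 \<partial>M)"
  proof (rule integral_dominated_convergence[where w="\<lambda>x. 2 * w x"])
    show "AE x in M. (\<lambda>N. cmod ((\<Sum>j. u j x) - (\<Sum>j<N. u j x))) \<longlonglongrightarrow> 0"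
      using AE
    proof eventually_elim
      case (elim x)
      then have "(\<lambda>j. u j x) sums (\<Sum>j. u j x)"
        by (rule summable_sums[OF summable_norm_cancel])
      then have "(\<lambda>N. (\<Sum>j. u j x) - (\<Sum>j<N. u j x)) \<longlonglongrightarrow> (\<Sum>j. u j x) - (\<Sum>j. u j x)"
        unfolding sums_def by (rule tendsto_diff[OF tendsto_const])
      then show ?case by (simp add: tendsto_norm_zero)
    qed
    show "AE x in M. norm (cmod ((\<Sum>j. u j x) - (\<Sum>j<N. u j x))) \<le> 2 * w x" for N
      using AE
    proof eventually_elim
      case (elim x)
      have "cmod (\<Sum>j. u j x) \<le> w x" unfolding w_def by (rule summable_norm[OF elim])
      moreover have "cmod (\<Sum>j<N. u j x) \<le> w x"
        unfolding w_def by (rule order_trans[OF norm_sum sum_le_suminf[OF elim]]) auto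
      ultimately show ?case
        using norm_triangle_ineq4[of "\<Sum>j. u j x" "\<Sum>j<N. u j x"] by simp
    qed
  qed (use w int in auto)
  then show "(\<lambda>N. \<integral>x. cmod ((\<Sum>j. u j x) - (\<Sum>j<N. u j x)) \<partial>M) \<longlonglongrightarrow> 0" by simp
qed

section \<open>Completeness of L^2 and the Riesz representation theorem\<close>

lemma norm2_parallelogram:
  assumes f: "square_integrable M f" and g: "square_integrable M g"
  shows "(norm2 M (\<lambda>x. f x + g x))\<^sup>2 + (norm2 M (\<lambda>x. f x - g x))\<^sup>2 =
         2 * (norm2 M f)\<^sup>2 + 2 * (norm2 M g)\<^sup>2"
proof -
  have "(norm2 M (\<lambda>x. f x + g x))\<^sup>2 + (norm2 M (\<lambda>x. f x - g x))\<^sup>2 =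
        (\<integral>x. (cmod (f x + g x))\<^sup>2 + (cmod (f x - g x))\<^sup>2 \<partial>M)"
    using square_integrable_add[OF f g] square_integrable_diff[OF f g]
    by (simp add: norm2_power2 square_integrable_def)
  also have "\<dots> = (\<integral>x. 2 * (cmod (f x))\<^sup>2 + 2 * (cmod (g x))\<^sup>2 \<partial>M)"
    by (simp add: cmod_power2 power2_sum power2_diff algebra_simps)
  also have "\<dots> = 2 * (norm2 M f)\<^sup>2 + 2 * (norm2 M g)\<^sup>2"
    using f g by (simp add: norm2_power2 square_integrable_def)
  finally show ?thesis .
qed

lemma norm2_power2_add:
  assumes f: "square_integrable M f" and g: "square_integrable M g"
  shows "(norm2 M (\<lambda>x. f x + g x))\<^sup>2 =
         (norm2 M f)\<^sup>2 + 2 * Re (\<integral>x. g x * cnj (f x) \<partial>M) + (norm2 M g)\<^sup>2"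
proof -
  have int: "integrable M (\<lambda>x. g x * cnj (f x))"
    by (rule square_integrable_mult[OF g square_integrable_cnj[OF f]])
  have "(norm2 M (\<lambda>x. f x + g x))\<^sup>2 =
        (\<integral>x. ((cmod (f x))\<^sup>2 + 2 * Re (g x * cnj (f x))) + (cmod (g x))\<^sup>2 \<partial>M)"
    unfolding norm2_power2 by (simp add: cmod_power2 power2_sum algebra_simps)
  also have "\<dots> = (\<integral>x. (cmod (f x))\<^sup>2 + 2 * Re (g x * cnj (f x)) \<partial>M) + (norm2 M g)\<^sup>2"
    unfolding norm2_power2 using f g int
    by (intro Bochner_Integration.integral_add Bochner_Integration.integrable_add
        integrable_mult_right integrable_Re) (auto simp: square_integrable_def)
  also have "(\<integral>x. (cmod (f x))\<^sup>2 + 2 * Re (g x * cnj (f x)) \<partial>M) =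
             (norm2 M f)\<^sup>2 + (\<integral>x. 2 * Re (g x * cnj (f x)) \<partial>M)"
    unfolding norm2_power2 using f g int
    by (intro Bochner_Integration.integral_add integrable_mult_right integrable_Re)
       (auto simp: square_integrable_def)
  also have "(\<integral>x. 2 * Re (g x * cnj (f x)) \<partial>M) = 2 * Re (\<integral>x. g x * cnj (f x) \<partial>M)"
    by (subst integral_mult_right_zero, subst integral_Re[OF int]) (rule refl)
  finally show ?thesis .
qed

text \<open>The geometric rate makes the increments \<open>u j\<close> absolutely summable in L^1
  (the measure is finite), so the whole sequence converges almost everywhere and no subsequence has
  to be extracted. The minimising sequence in the Riesz proof has exactly such a rate.\<close>

lemma (in finite_measure) square_integrable_complete:
  assumes F: "\<And>n. square_integrable M (F n)"
    and Cauchy: "\<And>m n. n \<le> m \<Longrightarrow> norm2 M (\<lambda>x. F m x - F n x) \<le> C * (1/2) ^ n"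
  obtains f where "square_integrable M f" "(\<lambda>n. norm2 M (\<lambda>x. f x - F n x)) \<longlonglongrightarrow> 0"
proof -
  have [measurable]: "F n \<in> borel_measurable M" for n
    using F by (simp add: square_integrable_def)
  define u where "u j x = F (Suc j) x - F j x" for j x
  have sq: "square_integrable M (u j)" for j
    unfolding u_def by (rule square_integrable_diff[OF F F])
  have C: "0 \<le> C"
    using order_trans[OF norm2_nonneg Cauchy[of 0 0]] by simp
  have "summable (\<lambda>j. \<integral>x. cmod (u j x) \<partial>M)"
  proof (rule summable_comparison_test')
    show "summable (\<lambda>j. C * sqrt (measure M (space M)) * (1/2) ^ j)"
      by (intro summable_mult summable_geometric) simp
    show "norm (\<integral>x. cmod (u j x) \<partial>M) \<le> C * sqrt (measure M (space M)) * (1/2) ^ j" for j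
    proof -
      have "norm (\<integral>x. cmod (u j x) \<partial>M) \<le> norm2 M (u j) * sqrt (measure M (space M))"
        using integral_cmod_le_norm2[OF sq] by simp
      also have "\<dots> \<le> (C * (1/2) ^ j) * sqrt (measure M (space M))"
        using Cauchy[of j "Suc j"] by (intro mult_right_mono) (auto simp: u_def[abs_def])
      finally show ?thesis by (simp add: algebra_simps)
    qed
  qed
  from summable_integral_norm_imp[OF integrable_square_integrable[OF sq] this]
  have AE: "AE x in M. summable (\<lambda>j. cmod (u j x))"
    and int: "integrable M (\<lambda>x. \<Sum>j. u j x)" by auto
  define f where "f x = F 0 x + (\<Sum>j. u j x)" for x
  have [measurable]: "f \<in> borel_measurable M"
    using int unfolding f_def by (intro borel_measurable_add) auto
  have lim: "AE x in M. (\<lambda>m. F m x) \<longlonglongrightarrow> f x"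
    using AE
  proof eventually_elim
    case (elim x)
    have "(\<lambda>m. F 0 x + (\<Sum>j<m. u j x)) \<longlonglongrightarrow> f x"
      unfolding f_def
      by (intro tendsto_add tendsto_const summable_LIMSEQ summable_norm_cancel[OF elim])
    moreover have "F 0 x + (\<Sum>j<m. u j x) = F m x" for m
      unfolding u_def sum_lessThan_telescope[of "\<lambda>j. F j x"] by simp
    ultimately show ?case by simp
  qed
  \<comment> \<open>Fatou's lemma, with \<open>n\<close> fixed and m tending to infinity, carries
    the Cauchy bound over to the pointwise limit; it also gives the square-integrability of the
    difference.\<close>
  have diff: "square_integrable M (\<lambda>x. f x - F n x) \<and> norm2 M (\<lambda>x. f x - F n x) \<le> C * (1/2) ^ n" for n
  proof -
    have "(\<integral>\<^sup>+x. ennreal ((cmod (f x - F n x))\<^sup>2) \<partial>M) =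
          (\<integral>\<^sup>+x. liminf (\<lambda>m. ennreal ((cmod (F m x - F n x))\<^sup>2)) \<partial>M)"
    proof (rule nn_integral_cong_AE)
      show "AE x in M. ennreal ((cmod (f x - F n x))\<^sup>2) =
              liminf (\<lambda>m. ennreal ((cmod (F m x - F n x))\<^sup>2))"
        using lim
      proof eventually_elim
        case (elim x)
        then have "(\<lambda>m. ennreal ((cmod (F m x - F n x))\<^sup>2)) \<longlonglongrightarrow> ennreal ((cmod (f x - F n x))\<^sup>2)"
          by (intro tendsto_ennrealI tendsto_power tendsto_norm tendsto_diff tendsto_const)
        then show ?case by (intro lim_imp_Liminf[symmetric]) auto
      qed
    qed
    also have "\<dots> \<le> liminf (\<lambda>m. \<integral>\<^sup>+x. ennreal ((cmod (F m x - F n x))\<^sup>2) \<partial>M)"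
      by (rule nn_integral_liminf) measurable
    also have "\<dots> \<le> ennreal ((C * (1/2) ^ n)\<^sup>2)"
    proof (rule Liminf_le)
      show "\<forall>\<^sub>F m in sequentially. (\<integral>\<^sup>+x. ennreal ((cmod (F m x - F n x))\<^sup>2) \<partial>M) \<le> ennreal ((C * (1/2) ^ n)\<^sup>2)"
        using eventually_ge_at_top[of n]
      proof eventually_elim
        case (elim m)
        have "(\<integral>\<^sup>+x. ennreal ((cmod (F m x - F n x))\<^sup>2) \<partial>M) = ennreal ((norm2 M (\<lambda>x. F m x - F n x))\<^sup>2)"
          using square_integrable_diff[OF F F, of m n]
          by (simp add: nn_integral_eq_integral norm2_power2 square_integrable_def)
        then show ?case
          using power_mono[OF Cauchy[OF elim] norm2_nonneg, of 2] by (simp add: ennreal_leI)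
      qed
    qed simp
    finally have le: "(\<integral>\<^sup>+x. ennreal ((cmod (f x - F n x))\<^sup>2) \<partial>M) \<le> ennreal ((C * (1/2) ^ n)\<^sup>2)" .
    then have int: "integrable M (\<lambda>x. (cmod (f x - F n x))\<^sup>2)"
      unfolding integrable_iff_bounded by (auto simp: le_less_trans)
    have "(norm2 M (\<lambda>x. f x - F n x))\<^sup>2 \<le> (C * (1/2) ^ n)\<^sup>2"
      using le nn_integral_eq_integral[OF int] by (simp add: norm2_power2)
    then have "norm2 M (\<lambda>x. f x - F n x) \<le> C * (1/2) ^ n"
      by (rule power2_le_imp_le) (use C in simp)
    with int show ?thesis by (simp add: square_integrable_def)
  qed
  show ?thesis
  proof
    show "square_integrable M f"
      using square_integrable_add[OF conjunct1[OF diff[of 0]] F[of 0]] by simp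
    show "(\<lambda>n. norm2 M (\<lambda>x. f x - F n x)) \<longlonglongrightarrow> 0"
    proof (rule tendsto_sandwich)
      show "\<forall>\<^sub>F n in sequentially. 0 \<le> norm2 M (\<lambda>x. f x - F n x)"
        by (simp add: norm2_nonneg)
      show "\<forall>\<^sub>F n in sequentially. norm2 M (\<lambda>x. f x - F n x) \<le> C * (1/2) ^ n"
        using diff by (intro always_eventually) blast
      show "(\<lambda>n. C * (1/2) ^ n) \<longlonglongrightarrow> 0"
        by (intro tendsto_mult_right_zero LIMSEQ_power_zero) simp
    qed simp
  qed
qed

text \<open>Variational proof: a minimising sequence of a quadratic functional is Cauchy by the
  parallelogram law, and stationarity at the limit is the representation. The pairing is bilinear,
  so the representing function is the conjugate of the limit.\<close>

lemma (in finite_measure) Riesz_representation_square_integrable: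
  fixes L :: "('a \<Rightarrow> complex) \<Rightarrow> complex"
  assumes add: "\<And>f g. square_integrable M f \<Longrightarrow> square_integrable M g \<Longrightarrow>
                  L (\<lambda>x. f x + g x) = L f + L g"
    and cmult: "\<And>c f. square_integrable M f \<Longrightarrow> L (\<lambda>x. c * f x) = c * L f"
    and bound: "\<And>f. square_integrable M f \<Longrightarrow> cmod (L f) \<le> K * norm2 M f"
  obtains b where "square_integrable M b"
    "\<And>f. square_integrable M f \<Longrightarrow> L f = (\<integral>x. f x * b x \<partial>M)"
proof -
  \<comment> \<open>If \<open>L\<close> is the inner product with some f0, then J f = |f - f0|^2 -
    |f0|^2 in L^2 norms, so the representing function is the minimiser of \<open>J\<close>.\<close>
  define J where "J f = (norm2 M f)\<^sup>2 - 2 * Re (L f)" for f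
  define I where "I = (INF f\<in>Collect (square_integrable M). J f)"
  have zero: "square_integrable M (\<lambda>x. 0)"
    by (rule square_integrable_bounded[of _ 0]) auto
  have J_ge: "- (K\<^sup>2) \<le> J f" if "square_integrable M f" for f
  proof -
    have "Re (L f) \<le> K * norm2 M f"
      using complex_Re_le_cmod[of "L f"] bound[OF that] by linarith
    then show ?thesis
      using zero_le_power2[of "norm2 M f - K"] unfolding J_def power2_diff
      by (simp add: algebra_simps)
  qed
  have bdd: "bdd_below (J ` Collect (square_integrable M))"
    using J_ge by (intro bdd_belowI2[of _ "- (K\<^sup>2)"]) auto
  have I_le: "I \<le> J f" if "square_integrable M f" for f
    unfolding I_def using bdd that by (intro cINF_lower) auto
  \<comment> \<open>The rate is (1/4)^n because \<open>gap\<close> below controls squared distances: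
    the distances themselves then decay like (1/2)^n.\<close>
  have "\<exists>f. square_integrable M f \<and> J f < I + (1/4) ^ n" for n :: nat
    using cINF_less_iff[OF _ bdd, of "I + (1/4) ^ n"] zero unfolding I_def[symmetric] by auto
  then obtain F where F: "\<And>n. square_integrable M (F n)" and JF: "\<And>n. J (F n) < I + (1/4) ^ n"
    by metis
  \<comment> \<open>The midpoint of f and g also has \<open>J\<close> at least \<open>I\<close>; the
    parallelogram law turns this into a bound on the distance of f and g.\<close>
  have gap: "(norm2 M (\<lambda>x. f x - g x))\<^sup>2 \<le> 2 * (J f + J g - 2 * I)"
    if f: "square_integrable M f" and g: "square_integrable M g" for f g
  proof -
    have s: "square_integrable M (\<lambda>x. f x + g x)" by (rule square_integrable_add[OF f g])
    have "I \<le> J (\<lambda>x. (1/2) * (f x + g x))"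
      by (intro I_le square_integrable_cmult s)
    also have "\<dots> = (norm2 M (\<lambda>x. f x + g x))\<^sup>2 / 4 - (Re (L f) + Re (L g))"
      unfolding J_def norm2_cmult cmult[OF s] add[OF f g]
      by (simp add: power2_eq_square add_divide_distrib)
    finally show ?thesis
      using norm2_parallelogram[OF f g] unfolding J_def by simp
  qed
  have "norm2 M (\<lambda>x. F m x - F n x) \<le> 2 * (1/2) ^ n" if "n \<le> m" for m n
  proof (rule power2_le_imp_le)
    define q where "q i = (1/4::real) ^ i" for i :: nat
    have "q m \<le> q n" unfolding q_def by (rule power_decreasing[OF that]) auto
    then have "(norm2 M (\<lambda>x. F m x - F n x))\<^sup>2 \<le> 4 * q n"
    proof -
      have *: "X \<le> 4 * p" if "X \<le> 2 * (a + b - 2 * i)" "a < i + p'" "b < i + p" "p' \<le> p"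
        for X a b i p p' :: real using that by argo
      show ?thesis
        by (rule *[OF gap[OF F F] JF[folded q_def] JF[folded q_def] \<open>q m \<le> q n\<close>])
    qed
    also have "q n = ((1/2) ^ n)\<^sup>2"
      unfolding q_def power2_eq_square power_mult_distrib[symmetric] by simp
    also have "4 * \<dots> = (2 * (1/2) ^ n)\<^sup>2"
      by (simp add: power_mult_distrib)
    finally show "(norm2 M (\<lambda>x. F m x - F n x))\<^sup>2 \<le> (2 * (1/2) ^ n)\<^sup>2" .
  qed simp
  from square_integrable_complete[OF F this]
  obtain f where f: "square_integrable M f" and lim: "(\<lambda>n. norm2 M (\<lambda>x. f x - F n x)) \<longlonglongrightarrow> 0"
    by blast
  have Re_L: "Re (L h) = Re (\<integral>x. h x * cnj (f x) \<partial>M)" if h: "square_integrable M h" for h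
  proof -
    \<comment> \<open>The summand 1 keeps \<open>H\<close> positive even when \<open>h\<close>
      vanishes almost everywhere, so that it can be divided by.\<close>
    define H where "H = (norm2 M h)\<^sup>2 + 1"
    define d where "d n = Re (\<integral>x. h x * cnj (F n x) \<partial>M) - Re (L h)" for n
    have H: "H > 0" unfolding H_def by (rule add_nonneg_pos) auto
    have d: "(d n)\<^sup>2 \<le> (1/4) ^ n * H" for n
    proof -
      \<comment> \<open>Minimiser of 2 t d + t^2 H over real t. Moving from \<open>F n\<close> in
        the direction \<open>h\<close> by this amount lowers \<open>J\<close> by at least (d n)^2 /
        H, which near-minimality of \<open>F n\<close> limits to (1/4)^n.\<close>
      define t where "t = - d n / H"
      have th: "square_integrable M (\<lambda>x. of_real t * h x)" by (rule square_integrable_cmult[OF h])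
      have "I \<le> J (\<lambda>x. F n x + of_real t * h x)"
        by (intro I_le square_integrable_add F th)
      also have "\<dots> = J (F n) + 2 * t * d n + t\<^sup>2 * (norm2 M h)\<^sup>2"
        unfolding J_def norm2_power2_add[OF F th] norm2_cmult add[OF F th] cmult[OF h] d_def
        by (simp add: mult.assoc power_mult_distrib algebra_simps)
      also have "\<dots> \<le> I + (1/4) ^ n + 2 * t * d n + t\<^sup>2 * H"
        using JF[of n] mult_left_mono[of "(norm2 M h)\<^sup>2" H "t\<^sup>2"] unfolding H_def by simp
      also have "I + (1/4) ^ n + 2 * t * d n + t\<^sup>2 * H = I + (1/4) ^ n - (d n)\<^sup>2 / H"
      proof -
        have "t * H = - d n" using H by (simp add: t_def)
        then have "t\<^sup>2 * H = - (t * d n)" by (simp add: power2_eq_square mult.assoc)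
        moreover have "t * d n = - ((d n)\<^sup>2 / H)" by (simp add: t_def power2_eq_square)
        ultimately show ?thesis by linarith
      qed
      finally have "(d n)\<^sup>2 / H \<le> (1/4) ^ n" by linarith
      then show ?thesis using H by (simp only: pos_divide_le_eq)
    qed
    have "(\<lambda>n. (d n)\<^sup>2) \<longlonglongrightarrow> 0"
    proof (rule tendsto_sandwich[of "\<lambda>_. 0" _ _ "\<lambda>n. (1/4) ^ n * H"])
      have "(\<lambda>n. (1/4) ^ n * H) \<longlonglongrightarrow> 0 * H"
        by (intro tendsto_mult_right LIMSEQ_power_zero) simp
      then show "(\<lambda>n. (1/4) ^ n * H) \<longlonglongrightarrow> 0" by simp
    qed (use d in auto)
    from tendsto_real_sqrt[OF this]
    have "(\<lambda>n. Re (\<integral>x. h x * cnj (F n x) \<partial>M) - Re (L h)) \<longlonglongrightarrow> 0"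
      unfolding d_def real_sqrt_abs real_sqrt_zero tendsto_rabs_zero_iff .
    then have 1: "(\<lambda>n. Re (\<integral>x. h x * cnj (F n x) \<partial>M)) \<longlonglongrightarrow> Re (L h)"
      by (rule LIM_zero_cancel)
    have "(\<lambda>n. \<integral>x. h x * cnj (F n x) \<partial>M) \<longlonglongrightarrow> (\<integral>x. h x * cnj (f x) \<partial>M)"
    proof (rule LIM_zero_cancel, rule tendsto_0_le[OF lim always_eventually, rule_format])
      fix n
      have "(\<integral>x. h x * cnj (F n x) \<partial>M) - (\<integral>x. h x * cnj (f x) \<partial>M) =
            (\<integral>x. h x * cnj (F n x - f x) \<partial>M)"
        by (subst Bochner_Integration.integral_diff[symmetric])
           (simp_all add: square_integrable_mult h F f square_integrable_cnj right_diff_distrib)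
      also have "cmod \<dots> \<le> norm2 M h * norm2 M (\<lambda>x. F n x - f x)"
        using norm_integral_mult_le[OF h square_integrable_cnj[OF square_integrable_diff[OF F[of n] f]]]
        unfolding norm2_cnj .
      also have "norm2 M (\<lambda>x. F n x - f x) = norm2 M (\<lambda>x. f x - F n x)"
        by (simp add: norm2_def norm_minus_commute)
      finally show "norm ((\<integral>x. h x * cnj (F n x) \<partial>M) - (\<integral>x. h x * cnj (f x) \<partial>M))
          \<le> norm (norm2 M (\<lambda>x. f x - F n x)) * norm2 M h"
        by (simp add: norm2_nonneg mult.commute)
    qed
    from tendsto_unique[OF _ 1 tendsto_Re[OF this]] show ?thesis by simp
  qed
  show ?thesis
  proof
    show b: "square_integrable M (\<lambda>x. cnj (f x))" by (rule square_integrable_cnj[OF f])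
    fix h assume h: "square_integrable M h"
    \<comment> \<open>The variation gives only real parts; complex homogeneity and Im z = Re (- i z)
      recover the imaginary part.\<close>
    have "Im (L h) = Re (L (\<lambda>x. - \<i> * h x))"
      unfolding cmult[OF h] by simp
    also have "\<dots> = Re (\<integral>x. - \<i> * (h x * cnj (f x)) \<partial>M)"
      unfolding Re_L[OF square_integrable_cmult[OF h, of "- \<i>"]] mult.assoc ..
    also have "\<dots> = Re (- \<i> * (\<integral>x. h x * cnj (f x) \<partial>M))"
      by (subst integral_mult_right_zero) (rule refl)
    also have "\<dots> = Im (\<integral>x. h x * cnj (f x) \<partial>M)"
      by simp
    finally show "L h = (\<integral>x. h x * cnj (f x) \<partial>M)"
      using Re_L[OF h] by (simp add: complex_eq_iff)
  qed
qed

subsection \<open>The Gauss measure\<close>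

lemma nn_integral_exp_neg_square_finite: "(\<integral>\<^sup>+x. ennreal (exp (- x\<^sup>2)) \<partial>lborel) < \<infinity>"
proof -
  \<comment> \<open>The standard deviation 1 / sqrt 2 turns the exponent of the normal density into
    - x^2; its normalising factor is then 1 / sqrt pi.\<close>
  have "integrable lborel (\<lambda>x. sqrt pi * normal_density 0 (1 / sqrt 2) x)"
    by (intro integrable_mult_right integrable_normal_density) simp
  also have "(\<lambda>x. sqrt pi * normal_density 0 (1 / sqrt 2) x) = (\<lambda>x. exp (- x\<^sup>2))"
    by (simp add: normal_density_def power_divide real_sqrt_divide)
  finally show ?thesis unfolding integrable_iff_bounded by simp
qed

text \<open>The exponential of a sum of squares factors over the coordinates, so the integral is a
  power of the one-dimensional one.\<close>

lemma nn_integral_exp_neg_norm_square_finite: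
  "(\<integral>\<^sup>+x. ennreal (exp (- (norm (x :: 'a::euclidean_space))\<^sup>2)) \<partial>lborel) < \<infinity>"
proof -
  have "(\<integral>\<^sup>+x. ennreal (exp (- (norm (x :: 'a))\<^sup>2)) \<partial>lborel) =
        (\<integral>\<^sup>+x. (\<Prod>b\<in>Basis. ennreal (exp (- ((x :: 'a) \<bullet> b)\<^sup>2))) \<partial>lborel)"
  proof (rule nn_integral_cong)
    fix x :: 'a
    have "(norm x)\<^sup>2 = (\<Sum>b\<in>Basis. (x \<bullet> b)\<^sup>2)"
      unfolding power2_norm_eq_inner by (subst euclidean_inner) (simp add: power2_eq_square)
    then have "exp (- (norm x)\<^sup>2) = (\<Prod>b\<in>Basis. exp (- (x \<bullet> b)\<^sup>2))"
      by (simp add: sum_negf[symmetric] exp_sum)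
    then show "ennreal (exp (- (norm x)\<^sup>2)) = (\<Prod>b\<in>Basis. ennreal (exp (- (x \<bullet> b)\<^sup>2)))"
      by (simp add: prod_ennreal)
  qed
  also have "\<dots> = (\<Prod>b\<in>(Basis::'a set). (\<integral>\<^sup>+x. ennreal (exp (- x\<^sup>2)) \<partial>lborel))"
    by (rule nn_integral_lborel_prod[where f="\<lambda>b x. ennreal (exp (- x\<^sup>2))"]) auto
  also have "\<dots> < \<infinity>"
    using nn_integral_exp_neg_square_finite by (simp add: power_less_top_ennreal)
  finally show ?thesis .
qed

lemma sets_gauss_measure [measurable_cong, simp]: "sets gauss_measure = sets borel"
  by (simp add: gauss_measure_def)

lemma space_gauss_measure [simp]: "space gauss_measure = UNIV"
  by (simp add: gauss_measure_def)

lemma measurable_gauss_measure [simp]: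
  "borel_measurable gauss_measure = borel_measurable borel"
  by (rule measurable_cong_sets) simp_all

lemma emeasure_gauss_measure:
  "A \<in> sets borel \<Longrightarrow> emeasure (gauss_measure :: (real^'n) measure) A =
     (\<integral>\<^sup>+x\<in>A. ennreal (pi powr (- real CARD('n) / 2) * exp (- (norm x)\<^sup>2)) \<partial>lborel)"
  unfolding gauss_measure_def by (subst emeasure_density) auto

lemma finite_measure_gauss_measure: "finite_measure (gauss_measure :: (real^'n) measure)"
proof (rule finite_measureI)
  have "emeasure (gauss_measure :: (real^'n) measure) UNIV =
      ennreal (pi powr (- real CARD('n) / 2)) * (\<integral>\<^sup>+x. ennreal (exp (- (norm (x :: real^'n))\<^sup>2)) \<partial>lborel)"
    by (simp add: emeasure_gauss_measure ennreal_mult nn_integral_cmult)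
  also have "\<dots> < \<infinity>"
    using nn_integral_exp_neg_norm_square_finite[where 'a="real^'n"]
    by (simp add: ennreal_mult_less_top)
  finally show "emeasure (gauss_measure :: (real^'n) measure) (space gauss_measure) \<noteq> \<infinity>"
    by simp
qed

interpretation gauss: finite_measure "gauss_measure :: (real^'n) measure"
  by (rule finite_measure_gauss_measure)

interpretation gauss_pair: pair_sigma_finite
  "gauss_measure :: (real^'n) measure" "gauss_measure :: (real^'n) measure"
  ..

section \<open>Size and Gauss measure of maximal admissible balls\<close>

lemma max_radius_pos: "0 < max_radius c"
  by (simp add: max_radius_def)

lemma max_radius_le_1: "max_radius c \<le> 1"
  by (simp add: max_radius_def)

text \<open>This is the defining feature of the radius: it bounds the cross term in the expansion of
  |x|^2 around \<open>c\<close>, and thereby keeps the Gauss density comparable to its value at the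
  centre.\<close>

lemma norm_mult_max_radius: "norm c * max_radius c \<le> 1"
proof (cases "c = 0")
  case False
  then have "norm c * max_radius c \<le> norm c * (1 / norm c)"
    unfolding max_radius_def by (intro mult_left_mono) auto
  then show ?thesis using False by simp
qed simp

text \<open>Since no radius exceeds 1, only the case of a radius below 1/2 matters. Then |c| > 2,
  and |y| >= |c| - 1 >= |c| / 2 because the ball has radius at most 1.\<close>

lemma max_radius_le_twice:
  assumes "y \<in> ball c (max_radius c)"
  shows "max_radius y \<le> 2 * max_radius c"
proof (cases "1 / 2 \<le> max_radius c")
  case True
  then show ?thesis using max_radius_le_1[of y] by linarith
next
  case False
  then have c: "c \<noteq> 0" "max_radius c = 1 / norm c" and "1 / norm c < 1 / 2"
    by (auto simp: max_radius_def min_def split: if_splits)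
  then have c2: "2 < norm c" by (simp add: field_simps)
  have "norm c \<le> norm y + 1"
    using assms norm_triangle_ineq2[of c y] max_radius_le_1[of c] by (simp add: dist_norm)
  then have y: "norm c \<le> 2 * norm y" using c2 by linarith
  with c2 have "norm y > 0" by linarith
  then have "max_radius y \<le> 1 / norm y" by (auto simp: max_radius_def)
  also have "\<dots> \<le> 2 * max_radius c"
    using y \<open>norm y > 0\<close> c(1) unfolding c(2) by (simp add: divide_simps)
  finally show ?thesis .
qed

lemma ball_twice_max_radius_subset:
  assumes "y \<in> ball c (max_radius c)"
  shows "ball y (2 * max_radius y) \<subseteq> ball c (5 * max_radius c)"
proof
  fix x assume "x \<in> ball y (2 * max_radius y)"
  then have "dist y x < 4 * max_radius c"
    using max_radius_le_twice[OF assms] by simp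
  moreover have "dist c y < max_radius c" using assms by simp
  ultimately have "dist c x < 5 * max_radius c"
    using dist_triangle[of c x y] by linarith
  then show "x \<in> ball c (5 * max_radius c)" by simp
qed

lemma measure_ball_pos:
  fixes c :: "real^'n"
  assumes "0 < r"
  shows "0 < measure gauss_measure (ball c r)"
proof -
  have "emeasure gauss_measure (ball c r) \<noteq> 0"
  proof
    assume "emeasure gauss_measure (ball c r) = 0"
    then have "AE x in lborel. x \<notin> ball c r"
      unfolding emeasure_gauss_measure[OF borel_open[OF open_ball]]
      by (subst (asm) nn_integral_0_iff_AE) (auto simp: indicator_def split: if_splits)
    then have "emeasure lborel (ball c r) = 0"
      by (subst (asm) AE_iff_measurable[of "ball c r"]) auto
    moreover have "0 < unit_ball_vol (real CARD('n)) * r ^ CARD('n)"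
      using assms by simp
    ultimately show False
      using emeasure_ball[of r c] assms by (simp add: ennreal_eq_0_iff not_le)
  qed
  then show ?thesis
    by (simp add: gauss.emeasure_eq_measure zero_less_measure_iff)
qed

text \<open>Expand |x|^2 = |c|^2 + 2 c.(x - c) + |x - c|^2. The cross term is at most 2s in modulus
  because |c| |x - c| <= s, and the last term lies between 0 and s^2; it is dropped in the upper
  bound for the exponential.\<close>

lemma exp_norm_ball_bounds:
  assumes "dist c x < s * max_radius c" "0 \<le> s"
  shows "exp (- (norm x)\<^sup>2) \<le> exp (2 * s) * exp (- (norm c)\<^sup>2)"
    and "exp (- (2 * s + s\<^sup>2)) * exp (- (norm c)\<^sup>2) \<le> exp (- (norm x)\<^sup>2)"
proof -
  have d: "norm (x - c) \<le> s * max_radius c"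
    using assms by (simp add: dist_norm norm_minus_commute)
  have "norm c * norm (x - c) \<le> s * (norm c * max_radius c)"
    using mult_left_mono[OF d norm_ge_zero[of c]] by (simp add: algebra_simps)
  also have "\<dots> \<le> s" using mult_left_mono[OF norm_mult_max_radius \<open>0 \<le> s\<close>, of c] by simp
  finally have cs: "norm c * norm (x - c) \<le> s" .
  have "s * max_radius c \<le> s" using mult_left_mono[OF max_radius_le_1 \<open>0 \<le> s\<close>] by simp
  then have sq: "(norm (x - c))\<^sup>2 \<le> s\<^sup>2" using d by (intro power_mono) auto
  have "(norm x)\<^sup>2 = (norm (c + (x - c)))\<^sup>2" by simp
  also have "\<dots> = (norm c)\<^sup>2 + 2 * (c \<bullet> (x - c)) + (norm (x - c))\<^sup>2"
    unfolding power2_norm_eq_inner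
    by (simp only: inner_add_left inner_add_right inner_commute[of "x - c" c])
  finally have eq: "(norm x)\<^sup>2 = (norm c)\<^sup>2 + 2 * (c \<bullet> (x - c)) + (norm (x - c))\<^sup>2" .
  have i: "\<bar>c \<bullet> (x - c)\<bar> \<le> s"
    using Cauchy_Schwarz_ineq2[of c "x - c"] cs by linarith
  show "exp (- (norm x)\<^sup>2) \<le> exp (2 * s) * exp (- (norm c)\<^sup>2)"
    unfolding exp_add[symmetric] exp_le_cancel_iff using eq i zero_le_power2[of "norm (x - c)"] by linarith
  show "exp (- (2 * s + s\<^sup>2)) * exp (- (norm c)\<^sup>2) \<le> exp (- (norm x)\<^sup>2)"
    unfolding exp_add[symmetric] exp_le_cancel_iff using eq i sq by linarith
qed

text \<open>The density is at most exp 10 times its value at the centre on the large ball (s = 5)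
  and at least exp (-3) times that value on the small one (s = 1); the quotient is exp 13. The power
  of 5 is the ratio of the Lebesgue volumes.\<close>

lemma gauss_measure_doubling:
  fixes c :: "real^'n"
  shows "measure gauss_measure (ball c (5 * max_radius c)) \<le>
         exp 13 * 5 ^ CARD('n) * measure gauss_measure (ball c (max_radius c))"
proof -
  let ?r = "max_radius c" and ?K = "pi powr (- real CARD('n) / 2)" and ?e = "exp (- (norm c)\<^sup>2)"
  let ?V = "unit_ball_vol (real CARD('n)) * ?r ^ CARD('n)"
  have vol: "emeasure lborel (ball c s) = ennreal (unit_ball_vol (real CARD('n)) * s ^ CARD('n))"
    if "0 \<le> s" for s using emeasure_ball[OF that, of c] by simp
  note pos = less_imp_le[OF max_radius_pos[of c]]
  have "emeasure gauss_measure (ball c (5 * ?r)) \<le>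
        (\<integral>\<^sup>+x. ennreal (?K * (exp 10 * ?e)) * indicator (ball c (5 * ?r)) x \<partial>lborel)"
    unfolding emeasure_gauss_measure[OF borel_open[OF open_ball]]
    using exp_norm_ball_bounds(1)[of c _ 5]
    by (intro nn_integral_mono) (auto simp: indicator_def intro!: ennreal_leI mult_left_mono)
  also have "\<dots> = ennreal (?K * (exp 10 * ?e) * (5 ^ CARD('n) * ?V))"
    using pos
    by (subst nn_integral_cmult_indicator)
       (simp_all add: vol ennreal_mult[symmetric] power_mult_distrib mult_ac)
  finally have 1: "measure gauss_measure (ball c (5 * ?r)) \<le> ?K * (exp 10 * ?e) * (5 ^ CARD('n) * ?V)"
    using pos by (simp add: gauss.emeasure_eq_measure)
  have "ennreal (?K * (exp (-3) * ?e) * ?V) =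
        (\<integral>\<^sup>+x. ennreal (?K * (exp (-3) * ?e)) * indicator (ball c ?r) x \<partial>lborel)"
    using pos by (subst nn_integral_cmult_indicator) (simp_all add: vol ennreal_mult[symmetric])
  also have "\<dots> \<le> emeasure gauss_measure (ball c ?r)"
    unfolding emeasure_gauss_measure[OF borel_open[OF open_ball]]
    using exp_norm_ball_bounds(2)[of c _ 1]
    by (intro nn_integral_mono) (auto simp: indicator_def intro!: ennreal_leI mult_left_mono)
  finally have 2: "?K * (exp (-3) * ?e) * ?V \<le> measure gauss_measure (ball c ?r)"
    by (simp add: gauss.emeasure_eq_measure)
  have "?K * (exp 10 * ?e) * (5 ^ CARD('n) * ?V) =
        exp 13 * 5 ^ CARD('n) * (?K * (exp (-3) * ?e) * ?V)"
    using exp_add[of 13 "- 3 :: real"] by (simp add: mult_ac)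
  also have "\<dots> \<le> exp 13 * 5 ^ CARD('n) * measure gauss_measure (ball c ?r)"
    using 2 by (intro mult_left_mono) auto
  finally show ?thesis using 1 by linarith
qed

text \<open>Tonelli's theorem needs joint measurability, but local integrability constrains
  \<open>k\<close> only on compact sets away from the diagonal. Resetting \<open>k\<close> to 0 on
  the diagonal makes it a pointwise limit of its restrictions to an exhaustion by such sets.\<close>

lemma kernel_measurable:
  fixes k :: "real^'n \<Rightarrow> real^'n \<Rightarrow> complex"
  assumes "locally_integrable_off_diagonal k"
  shows "(\<lambda>(x, y). if x = y then 0 else k x y) \<in> borel_measurable (gauss_measure \<Otimes>\<^sub>M gauss_measure)"
proof -
  define K :: "nat \<Rightarrow> ((real^'n) \<times> (real^'n)) set"
    where "K m = cball 0 (real m) \<inter> {p. 1 / real (Suc m) \<le> dist (fst p) (snd p)}" for m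
  have "compact (K m)" for m
    unfolding K_def
    by (intro compact_Int_closed compact_cball closed_Collect_le continuous_intros)
  moreover have "K m \<subseteq> {(x, y). x \<noteq> y}" for m
  proof
    fix p assume "p \<in> K m"
    then have "1 / real (Suc m) \<le> dist (fst p) (snd p)" by (simp add: K_def)
    moreover have "0 < 1 / real (Suc m)" by simp
    ultimately have "0 < dist (fst p) (snd p)" by linarith
    then show "p \<in> {(x, y). x \<noteq> y}" by (cases p) auto
  qed
  ultimately have meas: "(\<lambda>p. indicator (K m) p *\<^sub>R (case p of (x, y) \<Rightarrow> k x y))
      \<in> borel_measurable (gauss_measure \<Otimes>\<^sub>M gauss_measure)" for m
    using assms unfolding locally_integrable_off_diagonal_def set_integrable_def
    by (intro borel_measurable_integrable) blast
  show ?thesis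
  proof (rule borel_measurable_LIMSEQ_metric[OF meas])
    fix p :: "(real^'n) \<times> (real^'n)"
    obtain x y where p: "p = (x, y)" by (cases p)
    have "\<forall>\<^sub>F m in sequentially. indicator (K m) p *\<^sub>R (case p of (x, y) \<Rightarrow> k x y) =
            (case p of (x, y) \<Rightarrow> if x = y then 0 else k x y)"
    proof (cases "x = y")
      case True
      then have "p \<notin> K m" for m by (simp add: K_def p)
      then show ?thesis using True by (simp add: p)
    next
      case False
      have "\<forall>\<^sub>F m in sequentially. norm p \<le> real m"
        using filterlim_real_sequentially by (simp add: filterlim_at_top)
      moreover have "\<forall>\<^sub>F m in sequentially. 1 / real (Suc m) < dist x y"
        using order_tendstoD(2)[OF LIMSEQ_inverse_real_of_nat, of "dist x y"] False
        by (simp add: inverse_eq_divide)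
      ultimately show ?thesis
        by eventually_elim (use False in \<open>auto simp: K_def p\<close>)
    qed
    then show "(\<lambda>m. indicator (K m) p *\<^sub>R (case p of (x, y) \<Rightarrow> k x y))
        \<longlonglongrightarrow> (case p of (x, y) \<Rightarrow> if x = y then 0 else k x y)"
      by (rule tendsto_eventually)
  qed
qed

subsection \<open>Atoms\<close>

lemma norm2_indicator: "norm2 M (\<lambda>x. indicator E x) = sqrt (measure M (E \<inter> space M))"
proof -
  have "(\<integral>x. (cmod (indicator E x))\<^sup>2 \<partial>M) = (\<integral>x. indicator E x \<partial>M)"
    by (intro Bochner_Integration.integral_cong) (auto simp: indicator_def)
  then show ?thesis by (simp add: norm2_def)
qed

lemma (in finite_measure) integral_indicator_cmod_le_norm2:
  assumes "square_integrable M f" "E \<in> sets M"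
  shows "(\<integral>x. indicator E x * cmod (f x) \<partial>M) \<le> norm2 M f * sqrt (measure M E)"
proof -
  have "square_integrable M (\<lambda>x. indicator E x)"
    using assms(2) by (intro square_integrable_bounded[where C=1]) (auto simp: indicator_def)
  from Cauchy_Schwarz_norm2[OF assms(1) this]
  have "(\<integral>x. cmod (f x * indicator E x) \<partial>M) \<le> norm2 M f * sqrt (measure M E)"
    using sets.sets_into_space[OF assms(2)] by (simp add: norm2_indicator Int_absorb2)
  moreover have "cmod (f x * indicator E x) = indicator E x * cmod (f x)" for x
    by (simp add: indicator_def)
  ultimately show ?thesis by simp
qed

section \<open>The spaces L^1 and L^2 of the Gauss measure\<close>

lemma L2_iff: "f \<in> L2 \<longleftrightarrow> square_integrable gauss_measure f"
  by (simp add: L2_def square_integrable_def)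

lemma L2_norm_eq: "L2_norm f = norm2 gauss_measure f"
  by (simp add: L2_norm_def norm2_def)

lemma L2_subset_L1: "f \<in> L2 \<Longrightarrow> f \<in> L1"
  by (simp add: L2_iff L1_def gauss.integrable_square_integrable)

lemma L1_norm_nonneg: "0 \<le> L1_norm f"
  by (simp add: L1_norm_def)

lemma L1_norm_triangle:
  assumes "f \<in> L1" "g \<in> L1"
  shows "L1_norm (\<lambda>x. f x + g x) \<le> L1_norm f + L1_norm g"
proof -
  have "L1_norm (\<lambda>x. f x + g x) \<le> (\<integral>x. cmod (f x) + cmod (g x) \<partial>gauss_measure)"
    unfolding L1_norm_def using assms
    by (intro integral_mono) (auto simp: L1_def norm_triangle_ineq)
  also have "\<dots> = L1_norm f + L1_norm g"
    unfolding L1_norm_def using assms by (simp add: L1_def)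
  finally show ?thesis .
qed

lemma L1_norm_cmult: "L1_norm (\<lambda>x. c * f x) = cmod c * L1_norm f"
  by (simp add: L1_norm_def norm_mult)

lemma L1_norm_cong_AE:
  assumes "AE x in gauss_measure. f x = g x" "f \<in> L1" "g \<in> L1"
  shows "L1_norm f = L1_norm g"
  unfolding L1_norm_def using assms
  by (intro integral_cong_AE) (auto simp: L1_def)

lemma powr_minus_half:
  assumes "0 < (x :: real)"
  shows "x powr (- 1 / 2) = 1 / sqrt x"
  using assms powr_minus_divide[of x "1/2"] by (simp add: powr_half_sqrt)

lemma L1_norm_supported_in:
  assumes "a \<in> L2" "supported_in a E" "E \<in> sets borel"
  shows "L1_norm a \<le> L2_norm a * sqrt (measure gauss_measure E)"
proof -
  have "L1_norm a = (\<integral>x. indicator E x * cmod (a x) \<partial>gauss_measure)"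
    unfolding L1_norm_def using assms
    by (intro integral_cong_AE) (auto simp: supported_in_def indicator_def L2_def)
  then show ?thesis
    using gauss.integral_indicator_cmod_le_norm2[of a E] assms by (simp add: L2_iff L2_norm_eq)
qed

lemma H1_atoms_subset_L2: "H1_atoms \<subseteq> L2"
  unfolding H1_atoms_def by (auto simp: L2_def)

lemma local_h1_atoms_subset_L2: "local_h1_atoms \<subseteq> L2"
  using H1_atoms_subset_L2 by (auto simp: local_h1_atoms_def global_atoms_def)

lemma L1_norm_supported_in_ball_le_1:
  fixes a :: "real^'n \<Rightarrow> complex"
  assumes "a \<in> L2" "supported_in a (ball c r)" "0 < r"
    and "L2_norm a \<le> measure gauss_measure (ball c r) powr (- 1 / 2)"
  shows "L1_norm a \<le> 1"
proof -
  note pos = measure_ball_pos[OF \<open>0 < r\<close>, of c]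
  have "L1_norm a \<le> L2_norm a * sqrt (measure gauss_measure (ball c r))"
    by (rule L1_norm_supported_in[OF assms(1,2)]) simp
  also have "\<dots> \<le> 1 / sqrt (measure gauss_measure (ball c r)) * sqrt (measure gauss_measure (ball c r))"
    using assms(4) unfolding powr_minus_half[OF pos] by (rule mult_right_mono) simp
  finally show ?thesis using pos by simp
qed

text \<open>Every entry of a decomposition must be an atom, also where the coefficient is 0, hence
  the constant sequence.\<close>

lemma atomic_decomposition_atom:
  assumes "a \<in> A"
  shows "atomic_decomposition A a (\<lambda>j. if j = 0 then 1 else 0) (\<lambda>_. a)"
proof -
  have "(\<Sum>j<N. (if j = 0 then 1 else 0) * a x) = a x" if "1 \<le> N" for N :: nat and x
    using that by (subst sum_distrib_right[symmetric]) (simp add: sum.delta)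
  then have "\<forall>\<^sub>F N in sequentially. L1_norm (\<lambda>x. a x - (\<Sum>j<N. (if j = 0 then 1 else 0) * a x)) = 0"
    unfolding eventually_sequentially by (intro exI[of _ 1]) (simp add: L1_norm_def)
  moreover have "summable (\<lambda>j. cmod (if j = 0 then 1 else 0))"
    by (rule summable_finite[of "{0}"]) auto
  ultimately show ?thesis
    using assms unfolding atomic_decomposition_def by (auto intro: tendsto_eventually)
qed

lemma atomic_norm_nonneg:
  assumes "f \<in> atomic_space A"
  shows "0 \<le> atomic_norm A f"
  unfolding atomic_norm_def
proof (rule cInf_greatest)
  \<comment> \<open>The infimum of the empty set of reals is unspecified; membership in the atomic
    space rules this case out.\<close>
  show "{(\<Sum>j. cmod (lam j)) | lam a. atomic_decomposition A f lam a} \<noteq> {}"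
    using assms by (auto simp: atomic_space_def)
qed (auto simp: atomic_decomposition_def intro: suminf_nonneg)

lemma atomic_norm_atom_le_1:
  assumes "a \<in> A"
  shows "atomic_norm A a \<le> 1"
proof -
  have "(\<Sum>j. cmod (if j = 0 then 1 else 0)) = (\<Sum>j::nat. if j = 0 then 1 else (0 :: real))"
    by (intro suminf_cong) auto
  also have "\<dots> = 1" by (rule sums_unique[symmetric, OF sums_single])
  finally have *: "1 = (\<Sum>j::nat. cmod (if j = 0 then 1 else 0))" ..
  show ?thesis
    unfolding atomic_norm_def
  proof (rule cInf_lower)
    show "1 \<in> {(\<Sum>j. cmod (lam j)) | lam a'. atomic_decomposition A a lam a'}"
      using * atomic_decomposition_atom[OF assms] by (intro CollectI exI conjI)
    show "bdd_below {(\<Sum>j. cmod (lam j)) | lam a'. atomic_decomposition A a lam a'}"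
      by (intro bdd_belowI[of _ 0]) (auto simp: atomic_decomposition_def intro: suminf_nonneg)
  qed
qed

text \<open>This is how the hypotheses of boundedness on an atomic space are exploited: an atom is a
  one-term finite combination, so the extension agrees with \<open>T\<close> there, and its atomic
  norm is at most 1. The constant is \<open>\<bar>C\<bar>\<close> because \<open>C\<close> is not
  assumed nonnegative.\<close>

lemma bounded_to_L1_atoms:
  assumes "bounded_to_L1 A T" "A \<subseteq> L2" "\<And>f. f \<in> L2 \<Longrightarrow> T f \<in> L2"
  obtains K where "\<And>a. a \<in> A \<Longrightarrow> L1_norm (T a) \<le> K"
proof -
  from assms(1) obtain S C where S: "\<And>f. f \<in> atomic_space A \<Longrightarrow> S f \<in> L1"
    and C: "\<And>f. f \<in> atomic_space A \<Longrightarrow> L1_norm (S f) \<le> C * atomic_norm A f"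
    and ST: "\<And>f. f \<in> finite_combinations A \<Longrightarrow> AE x in gauss_measure. S f x = T f x"
    unfolding bounded_to_L1_def by blast
  show ?thesis
  proof
    fix a assume a: "a \<in> A"
    have sp: "a \<in> atomic_space A"
      using a assms(2) L2_subset_L1 atomic_decomposition_atom[OF a] unfolding atomic_space_def by blast
    have "a = (\<lambda>x. \<Sum>j<(1::nat). 1 * a x)" by simp
    then have "a \<in> finite_combinations A"
      unfolding finite_combinations_def using a
      by (intro CollectI exI[of _ "1::nat"] exI[of _ "\<lambda>_. 1"] exI[of _ "\<lambda>_. a"]) simp
    then have "L1_norm (T a) = L1_norm (S a)"
      using ST[of a] S[OF sp] L2_subset_L1[OF assms(3)] a assms(2)
      by (intro L1_norm_cong_AE) auto
    also have "\<dots> \<le> C * atomic_norm A a" by (rule C[OF sp])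
    also have "\<dots> \<le> \<bar>C\<bar> * 1"
      using atomic_norm_nonneg[OF sp] atomic_norm_atom_le_1[OF a] by (intro mult_mono) auto
    finally show "L1_norm (T a) \<le> \<bar>C\<bar>" by simp
  qed
qed

subsection \<open>Images of global atoms\<close>

text \<open>A non-integrable function has Bochner integral 0 by convention, so kernel integrals can
  be estimated without first establishing absolute convergence at the given point.\<close>

lemma norm_integral_le_nn_integral:
  fixes f :: "'a \<Rightarrow> complex"
  shows "ennreal (cmod (integral\<^sup>L M f)) \<le> (\<integral>\<^sup>+x. ennreal (cmod (f x)) \<partial>M)"
  by (cases "integrable M f") (auto simp: integral_norm_bound_ennreal not_integrable_integral_eq)

lemma I_infinity_ge:
  "(\<integral>\<^sup>+x\<in>- ball y (2 * max_radius y). ennreal (cmod (k x y)) \<partial>gauss_measure) \<le> I_infinity k"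
  unfolding I_infinity_def by (rule SUP_upper) simp

text \<open>Tonelli: for each y in the ball, the complement of the fivefold ball lies in the
  complement of 2B_y, so the inner integral in x is at most \<open>I_infinity k\<close>. Boundedness
  of \<open>f\<close> and its vanishing everywhere off the ball give access to the kernel identity,
  whose support is a topological closure.\<close>

lemma kernel_off_ball_bounded:
  fixes T :: "(real^'n \<Rightarrow> complex) \<Rightarrow> (real^'n \<Rightarrow> complex)"
  assumes k: "is_kernel_of k T"
    and f: "f \<in> borel_measurable borel" "bounded (range f)"
    and supp: "\<And>x. x \<notin> ball c (max_radius c) \<Longrightarrow> f x = 0"
  shows "(\<integral>\<^sup>+x\<in>- ball c (5 * max_radius c). ennreal (cmod (T f x)) \<partial>gauss_measure) \<le>
         I_infinity k * (\<integral>\<^sup>+y. ennreal (cmod (f y)) \<partial>gauss_measure)"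
proof -
  let ?B = "ball c (max_radius c)" and ?E = "- ball c (5 * max_radius c)"
  \<comment> \<open>Agrees with \<open>k\<close> wherever it is evaluated below, since x off the
    fivefold ball never meets y in the ball, but is jointly measurable.\<close>
  define kk where "kk = (\<lambda>(x, y). if x = y then 0 else k x y)"
  have kk[measurable]: "kk \<in> borel_measurable (gauss_measure \<Otimes>\<^sub>M gauss_measure)"
    using k kernel_measurable unfolding is_kernel_of_def kk_def by blast
  have [measurable]: "f \<in> borel_measurable borel" by fact
  have supp_sub: "support f \<subseteq> cball c (max_radius c)"
    unfolding support_def using supp ball_subset_cball by (intro closure_minimal) blast+
  then have "compact (support f)"
    using compact_Int_closed[OF compact_cball, of "support f" c "max_radius c"]
    by (simp add: support_def Int_absorb1)
  then have AE: "AE x in gauss_measure. x \<notin> support f \<longrightarrow> T f x = (\<integral>y. k x y * f y \<partial>gauss_measure)"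
    using k f unfolding is_kernel_of_def by blast
  have "(\<integral>\<^sup>+x\<in>?E. ennreal (cmod (T f x)) \<partial>gauss_measure) \<le>
        (\<integral>\<^sup>+x. (\<integral>\<^sup>+y. indicator ?E x * ennreal (cmod (kk (x, y))) * ennreal (cmod (f y)) \<partial>gauss_measure) \<partial>gauss_measure)"
  proof (rule nn_integral_mono_AE, use AE in eventually_elim)
    case (elim x)
    show ?case
    proof (cases "x \<in> ?E")
      case True
      then have xB: "x \<notin> cball c (max_radius c)"
        using max_radius_pos[of c] by auto
      then have "T f x = (\<integral>y. k x y * f y \<partial>gauss_measure)"
        using elim supp_sub by blast
      also have "\<dots> = (\<integral>y. kk (x, y) * f y \<partial>gauss_measure)"
        using xB supp[of x] by (intro Bochner_Integration.integral_cong) (auto simp: kk_def)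
      finally have "ennreal (cmod (T f x)) \<le> (\<integral>\<^sup>+y. ennreal (cmod (kk (x, y) * f y)) \<partial>gauss_measure)"
        using norm_integral_le_nn_integral by metis
      then show ?thesis using True by (simp add: norm_mult ennreal_mult)
    qed simp
  qed
  also have "\<dots> = (\<integral>\<^sup>+y. (\<integral>\<^sup>+x. indicator ?E x * ennreal (cmod (kk (x, y))) * ennreal (cmod (f y)) \<partial>gauss_measure) \<partial>gauss_measure)"
    by (rule gauss_pair.Fubini'[symmetric]) measurable
  also have "\<dots> \<le> (\<integral>\<^sup>+y. I_infinity k * ennreal (cmod (f y)) \<partial>gauss_measure)"
  proof (rule nn_integral_mono)
    fix y :: "real^'n"
    show "(\<integral>\<^sup>+x. indicator ?E x * ennreal (cmod (kk (x, y))) * ennreal (cmod (f y)) \<partial>gauss_measure)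
        \<le> I_infinity k * ennreal (cmod (f y))"
    proof (cases "y \<in> ?B")
      case True
      have "(\<integral>\<^sup>+x. indicator ?E x * ennreal (cmod (kk (x, y))) * ennreal (cmod (f y)) \<partial>gauss_measure) =
            (\<integral>\<^sup>+x. indicator ?E x * ennreal (cmod (kk (x, y))) \<partial>gauss_measure) * ennreal (cmod (f y))"
        by (rule nn_integral_multc) measurable
      also have "\<dots> \<le> I_infinity k * ennreal (cmod (f y))"
      proof (rule mult_right_mono)
        have "(\<integral>\<^sup>+x. indicator ?E x * ennreal (cmod (kk (x, y))) \<partial>gauss_measure) \<le>
              (\<integral>\<^sup>+x\<in>- ball y (2 * max_radius y). ennreal (cmod (k x y)) \<partial>gauss_measure)"
          using ball_twice_max_radius_subset[OF True]
          by (intro nn_integral_mono) (auto simp: indicator_def kk_def)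
        also have "\<dots> \<le> I_infinity k" by (rule I_infinity_ge)
        finally show "(\<integral>\<^sup>+x. indicator ?E x * ennreal (cmod (kk (x, y))) \<partial>gauss_measure) \<le> I_infinity k" .
      qed simp
      finally show ?thesis .
    qed (simp add: supp)
  qed
  also have "\<dots> = I_infinity k * (\<integral>\<^sup>+y. ennreal (cmod (f y)) \<partial>gauss_measure)"
    by (rule nn_integral_cmult) measurable
  finally show ?thesis .
qed

lemma bounded_linear_operator_on_L2D:
  assumes "bounded_linear_operator_on_L2 T"
  shows "\<And>f. f \<in> L2 \<Longrightarrow> T f \<in> L2"
    and "\<And>f g \<alpha> \<beta>. f \<in> L2 \<Longrightarrow> g \<in> L2 \<Longrightarrow> AE x in gauss_measure.
           T (\<lambda>z. \<alpha> * f z + \<beta> * g z) x = \<alpha> * T f x + \<beta> * T g x"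
    and "\<exists>C\<ge>0. \<forall>f\<in>L2. L2_norm (T f) \<le> C * L2_norm f"
proof -
  obtain C where C: "\<And>f. f \<in> L2 \<Longrightarrow> L2_norm (T f) \<le> C * L2_norm f"
    using assms unfolding bounded_linear_operator_on_L2_def by blast
  have "L2_norm (T f) \<le> \<bar>C\<bar> * L2_norm f" if "f \<in> L2" for f
    using C[OF that] mult_right_mono[OF abs_ge_self[of C] norm2_nonneg[of gauss_measure f]]
    unfolding L2_norm_eq by linarith
  then show "\<exists>C\<ge>0. \<forall>f\<in>L2. L2_norm (T f) \<le> C * L2_norm f"
    by (intro exI[of _ "\<bar>C\<bar>"]) simp
qed (use assms in \<open>auto simp: bounded_linear_operator_on_L2_def\<close>)

text \<open>The kernel identity covers bounded functions only. An L^2 function is approximated in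
  L^2 by its cut-offs; the error passes through \<open>T\<close> by L^2 boundedness and then into
  L^1 by Cauchy-Schwarz, the measure being finite.\<close>

lemma kernel_off_ball_L2:
  fixes T :: "(real^'n \<Rightarrow> complex) \<Rightarrow> (real^'n \<Rightarrow> complex)"
  assumes T: "bounded_linear_operator_on_L2 T" and k: "is_kernel_of k T"
    and J: "I_infinity k = ennreal J" "0 \<le> J"
    and a: "a \<in> L2" "supported_in a (ball c (max_radius c))"
  shows "(\<integral>x. indicator (- ball c (5 * max_radius c)) x * cmod (T a x) \<partial>gauss_measure) \<le> J * L1_norm a"
proof -
  let ?B = "ball c (max_radius c)" and ?E = "- ball c (5 * max_radius c)"
  let ?m = "sqrt (measure gauss_measure ?E)"
  obtain C where C: "C \<ge> 0" "\<And>f. f \<in> L2 \<Longrightarrow> L2_norm (T f) \<le> C * L2_norm f"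
    using bounded_linear_operator_on_L2D(3)[OF T] by blast
  note TL2 = bounded_linear_operator_on_L2D(1)[OF T]
  have am[measurable]: "a \<in> borel_measurable borel" using a(1) by (simp add: L2_def)
  \<comment> \<open>The cut-off also forces the value 0 everywhere off the ball; \<open>a\<close>
    vanishes there only almost everywhere, so its topological support could be larger.\<close>
  define b where "b m x = (if x \<in> ?B \<and> cmod (a x) \<le> real m then a x else 0)" for m :: nat and x
  have bm[measurable]: "b m \<in> borel_measurable borel" for m
  proof -
    have [measurable]: "?B \<in> sets borel" by simp
    show ?thesis unfolding b_def by measurable
  qed
  have b_le: "cmod (b m x) \<le> cmod (a x)" for m x by (simp add: b_def)
  have b_bd: "cmod (b m x) \<le> real m" for m x by (simp add: b_def)
  have bL2: "b m \<in> L2" for m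
    unfolding L2_iff by (rule gauss.square_integrable_bounded[OF _ b_bd]) simp
  have dL2: "(\<lambda>x. a x - b m x) \<in> L2" for m
    using square_integrable_diff a(1) bL2 unfolding L2_iff by blast
  have int_a: "integrable gauss_measure (\<lambda>x. (cmod (a x))\<^sup>2)" using a(1) by (simp add: L2_def)
  have "(\<lambda>m. \<integral>x. (cmod (a x - b m x))\<^sup>2 \<partial>gauss_measure) \<longlonglongrightarrow>
      (\<integral>x. 0 \<partial>(gauss_measure :: (real^'n) measure))"
  proof (rule integral_dominated_convergence[where w="\<lambda>x. (cmod (a x))\<^sup>2"])
    show "AE x in gauss_measure. (\<lambda>m. (cmod (a x - b m x))\<^sup>2) \<longlonglongrightarrow> 0"
      using a(2) unfolding supported_in_def
    proof eventually_elim
      case (elim x)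
      have "\<forall>\<^sub>F m in sequentially. cmod (a x) \<le> real m"
        using filterlim_real_sequentially by (simp add: filterlim_at_top)
      then have "\<forall>\<^sub>F m in sequentially. (cmod (a x - b m x))\<^sup>2 = 0"
        by eventually_elim (use elim in \<open>auto simp: b_def\<close>)
      then show ?case by (rule tendsto_eventually)
    qed
    show "AE x in gauss_measure. norm ((cmod (a x - b m x))\<^sup>2) \<le> (cmod (a x))\<^sup>2" for m
      by (simp add: b_def)
  qed (use int_a in simp_all)
  then have "(\<lambda>m. L2_norm (\<lambda>x. a x - b m x)) \<longlonglongrightarrow> 0"
    unfolding L2_norm_def using tendsto_real_sqrt by fastforce
  then have lim: "(\<lambda>m. J * L1_norm a + C * L2_norm (\<lambda>x. a x - b m x) * ?m) \<longlonglongrightarrow> J * L1_norm a + C * 0 * ?m"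
    by (intro tendsto_intros)
  have "(\<integral>x. indicator ?E x * cmod (T a x) \<partial>gauss_measure) \<le>
        J * L1_norm a + C * L2_norm (\<lambda>x. a x - b m x) * ?m" for m
  proof -
    let ?d = "\<lambda>x. a x - b m x"
    have int: "integrable gauss_measure (\<lambda>x. indicator ?E x * cmod (g x))" if "g \<in> L2" for g
      using integrable_real_mult_indicator[of ?E gauss_measure "\<lambda>x. cmod (g x)"] L2_subset_L1[OF that]
      by (simp add: L1_def mult.commute)
    have "AE x in gauss_measure. T (\<lambda>z. 1 * b m z + 1 * ?d z) x = 1 * T (b m) x + 1 * T ?d x"
      by (rule bounded_linear_operator_on_L2D(2)[OF T bL2 dL2])
    then have Ta: "AE x in gauss_measure. T a x = T (b m) x + T ?d x" by simp
    have "(\<integral>x. indicator ?E x * cmod (T a x) \<partial>gauss_measure) \<le>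
        (\<integral>x. indicator ?E x * cmod (T (b m) x) + indicator ?E x * cmod (T ?d x) \<partial>gauss_measure)"
    proof (rule integral_mono_AE)
      show "AE x in gauss_measure. indicator ?E x * cmod (T a x) \<le>
          indicator ?E x * cmod (T (b m) x) + indicator ?E x * cmod (T ?d x)"
        using Ta by eventually_elim (simp add: indicator_def norm_triangle_ineq)
    qed (intro int Bochner_Integration.integrable_add TL2 a bL2 dL2)+
    also have "\<dots> = (\<integral>x. indicator ?E x * cmod (T (b m) x) \<partial>gauss_measure) +
        (\<integral>x. indicator ?E x * cmod (T ?d x) \<partial>gauss_measure)"
      by (intro Bochner_Integration.integral_add int TL2 bL2 dL2)
    also have "(\<integral>x. indicator ?E x * cmod (T (b m) x) \<partial>gauss_measure) \<le> J * L1_norm a"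
    proof -
      have "ennreal (\<integral>x. indicator ?E x * cmod (T (b m) x) \<partial>gauss_measure) =
            (\<integral>\<^sup>+x\<in>?E. ennreal (cmod (T (b m) x)) \<partial>gauss_measure)"
        by (subst nn_integral_eq_integral[symmetric, OF int[OF TL2[OF bL2]]])
           (auto intro!: nn_integral_cong simp: indicator_def)
      also have "\<dots> \<le> I_infinity k * (\<integral>\<^sup>+y. ennreal (cmod (b m y)) \<partial>gauss_measure)"
        using b_bd by (intro kernel_off_ball_bounded[OF k] boundedI[of _ "real m"]) (auto simp: b_def)
      also have "\<dots> \<le> I_infinity k * (\<integral>\<^sup>+y. ennreal (cmod (a y)) \<partial>gauss_measure)"
        using b_le by (intro mult_left_mono nn_integral_mono ennreal_leI) auto
      also have "(\<integral>\<^sup>+y. ennreal (cmod (a y)) \<partial>gauss_measure) = ennreal (L1_norm a)"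
        unfolding L1_norm_def using L2_subset_L1[OF a(1)]
        by (intro nn_integral_eq_integral) (auto simp: L1_def)
      finally have "ennreal (\<integral>x. indicator ?E x * cmod (T (b m) x) \<partial>gauss_measure) \<le> ennreal (J * L1_norm a)"
        by (simp add: J ennreal_mult L1_norm_nonneg)
      then show ?thesis using J(2) L1_norm_nonneg[of a] by (simp add: ennreal_le_iff)
    qed
    also have "(\<integral>x. indicator ?E x * cmod (T ?d x) \<partial>gauss_measure) \<le> L2_norm (T ?d) * ?m"
      unfolding L2_norm_eq using TL2[OF dL2]
      by (intro gauss.integral_indicator_cmod_le_norm2) (auto simp: L2_iff)
    also have "\<dots> \<le> C * L2_norm ?d * ?m"
      by (intro mult_right_mono C dL2) simp
    finally show ?thesis by simp
  qed
  then show ?thesis using LIMSEQ_le_const[OF lim] by auto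
qed

lemma global_atom_bound:
  fixes T :: "(real^'n \<Rightarrow> complex) \<Rightarrow> (real^'n \<Rightarrow> complex)"
  assumes T: "bounded_linear_operator_on_L2 T" and k: "is_kernel_of k T"
    and I: "I_infinity k < \<infinity>"
  obtains K where "\<And>a. a \<in> global_atoms \<Longrightarrow> L1_norm (T a) \<le> K"
proof -
  define J where "J = enn2real (I_infinity k)"
  have J: "I_infinity k = ennreal J" "0 \<le> J" using I by (simp_all add: J_def)
  obtain C where C: "C \<ge> 0" "\<And>f. f \<in> L2 \<Longrightarrow> L2_norm (T f) \<le> C * L2_norm f"
    using bounded_linear_operator_on_L2D(3)[OF T] by blast
  note TL2 = bounded_linear_operator_on_L2D(1)[OF T]
  define D :: real where "D = exp 13 * 5 ^ CARD('n)"
  have D: "D > 0" by (simp add: D_def)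
  show ?thesis
  proof
    fix a :: "real^'n \<Rightarrow> complex" assume "a \<in> global_atoms"
    then obtain c where a: "a \<in> L2" and supp: "supported_in a (ball c (max_radius c))"
      and a_le: "L2_norm a \<le> measure gauss_measure (ball c (max_radius c)) powr (- 1 / 2)"
      unfolding global_atoms_def by blast
    let ?B = "ball c (max_radius c)" and ?B5 = "ball c (5 * max_radius c)"
    note pos = measure_ball_pos[OF max_radius_pos[of c], of c]
    have Ta: "T a \<in> L2" "T a \<in> L1" using TL2[OF a] L2_subset_L1 by auto
    have int: "integrable gauss_measure (\<lambda>x. indicator E x * cmod (T a x))" if "E \<in> sets borel" for E
      using integrable_real_mult_indicator[of E gauss_measure "\<lambda>x. cmod (T a x)"] Ta(2) that
      by (simp add: L1_def mult.commute)
    have "(\<integral>x. indicator ?B5 x * cmod (T a x) \<partial>gauss_measure) \<le> L2_norm (T a) * sqrt (measure gauss_measure ?B5)"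
      unfolding L2_norm_eq using Ta
      by (intro gauss.integral_indicator_cmod_le_norm2) (auto simp: L2_iff)
    \<comment> \<open>The normalisation of the atom cancels the square root of the measure of the
      ball, leaving a bound independent of the ball.\<close>
    also have "\<dots> \<le> (C * (1 / sqrt (measure gauss_measure ?B))) * (sqrt D * sqrt (measure gauss_measure ?B))"
    proof (intro mult_mono)
      show "L2_norm (T a) \<le> C * (1 / sqrt (measure gauss_measure ?B))"
        using C(2)[OF a] mult_left_mono[OF a_le C(1)] unfolding powr_minus_half[OF pos] by linarith
      show "sqrt (measure gauss_measure ?B5) \<le> sqrt D * sqrt (measure gauss_measure ?B)"
        using gauss_measure_doubling[of c] unfolding D_def real_sqrt_mult[symmetric]
        by (rule real_sqrt_le_mono)
    qed (use C(1) in auto)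
    also have "\<dots> = C * sqrt D" using pos by simp
    finally have 1: "(\<integral>x. indicator ?B5 x * cmod (T a x) \<partial>gauss_measure) \<le> C * sqrt D" .
    have "(\<integral>x. indicator (- ?B5) x * cmod (T a x) \<partial>gauss_measure) \<le> J * L1_norm a"
      by (rule kernel_off_ball_L2[OF T k J a supp])
    also have "\<dots> \<le> J * 1"
      by (intro mult_left_mono J L1_norm_supported_in_ball_le_1[OF a supp max_radius_pos a_le])
    finally have 2: "(\<integral>x. indicator (- ?B5) x * cmod (T a x) \<partial>gauss_measure) \<le> J" by simp
    have "L1_norm (T a) = (\<integral>x. indicator ?B5 x * cmod (T a x) + indicator (- ?B5) x * cmod (T a x) \<partial>gauss_measure)"
      unfolding L1_norm_def by (intro Bochner_Integration.integral_cong) (auto simp: indicator_def)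
    also have "\<dots> = (\<integral>x. indicator ?B5 x * cmod (T a x) \<partial>gauss_measure) +
        (\<integral>x. indicator (- ?B5) x * cmod (T a x) \<partial>gauss_measure)"
      by (intro Bochner_Integration.integral_add int) auto
    finally show "L1_norm (T a) \<le> C * sqrt D + J" using 1 2 by linarith
  qed
qed

subsection \<open>Duality\<close>

text \<open>Metric projection onto the disc of radius \<open>s\<close>. Projections onto convex sets
  are nonexpansive, so truncating a function at height \<open>s\<close> cannot increase its
  oscillation about a constant once that constant is truncated as well.\<close>

definition truncation :: "real \<Rightarrow> complex \<Rightarrow> complex" where
  "truncation s = closest_point (cball 0 s)"

lemma norm_truncation_le: "0 \<le> s \<Longrightarrow> cmod (truncation s z) \<le> s"
  using closest_point_in_set[of "cball (0::complex) s" z] by (simp add: truncation_def)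

lemma truncation_eq: "cmod z \<le> s \<Longrightarrow> truncation s z = z"
  unfolding truncation_def by (rule closest_point_self) simp

lemma truncation_lipschitz:
  assumes "0 \<le> s"
  shows "cmod (truncation s z - truncation s w) \<le> cmod (z - w)"
  using closest_point_lipschitz[of "cball (0::complex) s" z w] assms
  by (simp add: truncation_def dist_norm)

lemma norm_truncation_le_norm: "0 \<le> s \<Longrightarrow> cmod (truncation s z) \<le> cmod z"
  using truncation_lipschitz[of s z 0] by (simp add: truncation_eq)

lemma borel_measurable_truncation:
  assumes "0 \<le> s" "f \<in> borel_measurable M"
  shows "(\<lambda>x. truncation s (f x)) \<in> borel_measurable M"
  unfolding truncation_def using assms
  by (intro borel_measurable_continuous_on[OF continuous_on_closest_point]) auto

text \<open>The function \<open>b\<close> is the image of \<open>p\<close> under the transpose of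
  \<open>T\<close> for the bilinear pairing, obtained from the Riesz theorem.\<close>

lemma operator_pairing_representation:
  fixes T :: "(real^'n \<Rightarrow> complex) \<Rightarrow> (real^'n \<Rightarrow> complex)"
  assumes T: "bounded_linear_operator_on_L2 T"
    and p: "p \<in> borel_measurable borel" "\<And>x. cmod (p x) \<le> 1"
  obtains b where "b \<in> L2"
    "\<And>f. f \<in> L2 \<Longrightarrow> (\<integral>x. p x * T f x \<partial>gauss_measure) = (\<integral>x. f x * b x \<partial>gauss_measure)"
proof -
  let ?\<gamma> = "gauss_measure :: (real^'n) measure"
  note TL2 = bounded_linear_operator_on_L2D(1)[OF T, unfolded L2_iff]
  note lin = bounded_linear_operator_on_L2D(2)[OF T, unfolded L2_iff]
  obtain C where C: "C \<ge> 0" "\<And>f. f \<in> L2 \<Longrightarrow> L2_norm (T f) \<le> C * L2_norm f"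
    using bounded_linear_operator_on_L2D(3)[OF T] by blast
  have sp: "square_integrable ?\<gamma> p"
    by (rule gauss.square_integrable_bounded[of _ 1]) (use p in auto)
  have int: "integrable ?\<gamma> (\<lambda>x. p x * T f x)" if "square_integrable ?\<gamma> f" for f
    by (rule square_integrable_mult[OF sp TL2[OF that]])
  have zero: "square_integrable ?\<gamma> (\<lambda>x. 0)"
    by (rule gauss.square_integrable_bounded[of _ 0]) auto
  define L where "L f = (\<integral>x. p x * T f x \<partial>?\<gamma>)" for f
  \<comment> \<open>\<open>T\<close> is linear only up to null sets; integration turns this into the
    exact linearity that the Riesz theorem asks for.\<close>
  have comb: "L (\<lambda>x. \<alpha> * f x + \<beta> * g x) = \<alpha> * L f + \<beta> * L g"
    if f: "square_integrable ?\<gamma> f" and g: "square_integrable ?\<gamma> g" for f g \<alpha> \<beta>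
  proof -
    have s: "square_integrable ?\<gamma> (\<lambda>x. \<alpha> * f x + \<beta> * g x)"
      by (intro square_integrable_add square_integrable_cmult f g)
    have "L (\<lambda>x. \<alpha> * f x + \<beta> * g x) = (\<integral>x. \<alpha> * (p x * T f x) + \<beta> * (p x * T g x) \<partial>?\<gamma>)"
      unfolding L_def
    proof (rule integral_cong_AE)
      show "AE x in ?\<gamma>. p x * T (\<lambda>x. \<alpha> * f x + \<beta> * g x) x = \<alpha> * (p x * T f x) + \<beta> * (p x * T g x)"
        using lin[OF f g, of \<alpha> \<beta>] by eventually_elim (simp add: algebra_simps)
    qed (use int[OF s] int[OF f] int[OF g] in auto)
    also have "\<dots> = \<alpha> * L f + \<beta> * L g"
      unfolding L_def using int[OF f] int[OF g] by simp
    finally show ?thesis .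
  qed
  have "cmod (L f) \<le> norm2 ?\<gamma> p * C * norm2 ?\<gamma> f" if f: "square_integrable ?\<gamma> f" for f
  proof -
    have "cmod (L f) \<le> norm2 ?\<gamma> p * norm2 ?\<gamma> (T f)"
      unfolding L_def by (rule norm_integral_mult_le[OF sp TL2[OF f]])
    also have "\<dots> \<le> norm2 ?\<gamma> p * (C * norm2 ?\<gamma> f)"
      using C(2)[of f] f by (intro mult_left_mono norm2_nonneg) (simp add: L2_iff L2_norm_eq)
    finally show ?thesis by (simp add: mult.assoc)
  qed
  note bound = this
  have add: "L (\<lambda>x. f x + g x) = L f + L g"
    if "square_integrable ?\<gamma> f" "square_integrable ?\<gamma> g" for f g
    using comb[OF that, of 1 1] by simp
  have cmult: "L (\<lambda>x. c * f x) = c * L f" if "square_integrable ?\<gamma> f" for f c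
    using comb[OF that zero, of c 0] by simp
  from gauss.Riesz_representation_square_integrable[OF add cmult bound]
  obtain b where "square_integrable ?\<gamma> b"
    "\<And>f. square_integrable ?\<gamma> f \<Longrightarrow> L f = (\<integral>x. f x * b x \<partial>?\<gamma>)"
    by blast
  then show ?thesis by (intro that[of b]) (simp_all add: L2_iff L_def)
qed

text \<open>\<open>b\<close> is tested against the multiple of \<open>cnj u\<close> that satisfies the size condition of an atom.\<close>

lemma oscillation_bound_aux:
  fixes b u :: "real^'n \<Rightarrow> complex"
  assumes u: "u \<in> L2" and g: "0 < g" and K: "0 \<le> K"
    and self: "(\<integral>x. cnj (u x) * b x \<partial>gauss_measure) = of_real ((L2_norm u)\<^sup>2)"
    and atom: "\<And>s. s = complex_of_real (1 / (L2_norm u * sqrt g)) \<Longrightarrow> L2_norm (\<lambda>x. s * cnj (u x)) \<le> g powr (- 1 / 2) \<Longrightarrow>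
       cmod (\<integral>x. s * cnj (u x) * b x \<partial>gauss_measure) \<le> K"
  shows "L2_norm u \<le> K * sqrt g"
proof (cases "L2_norm u = 0")
  case False
  then have pos: "0 < L2_norm u" using norm2_nonneg[of gauss_measure u] by (simp add: L2_norm_eq)
  define s where "s = complex_of_real (1 / (L2_norm u * sqrt g))"
  have s: "cmod s = 1 / (L2_norm u * sqrt g)"
    using pos g unfolding s_def norm_of_real by simp
  have "L2_norm (\<lambda>x. s * cnj (u x)) = cmod s * L2_norm u"
    by (simp add: L2_norm_eq norm2_cmult norm2_cnj)
  also have "\<dots> = g powr (- 1 / 2)"
    using pos g unfolding s powr_minus_half[OF g] by simp
  finally have "cmod (\<integral>x. s * cnj (u x) * b x \<partial>gauss_measure) \<le> K"
    using atom[OF s_def] by simp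
  moreover have "(\<integral>x. s * cnj (u x) * b x \<partial>gauss_measure) = s * of_real ((L2_norm u)\<^sup>2)"
    unfolding self[symmetric] mult.assoc by (rule integral_mult_right_zero)
  ultimately have "L2_norm u / sqrt g \<le> K"
    using pos by (simp add: norm_mult s norm_power power2_eq_square)
  then show ?thesis using g by (simp add: pos_divide_le_eq)
qed (use K g in simp)

lemma square_integrable_indicator_mult:
  assumes "square_integrable M f" "E \<in> sets M"
  shows "square_integrable M (\<lambda>x. indicator E x * f x)"
proof -
  have [measurable]: "f \<in> borel_measurable M" "E \<in> sets M"
    using assms by (simp_all add: square_integrable_def)
  show ?thesis
    by (rule norm2_mono(1)[OF assms(1)]) (measurable, auto simp: indicator_def)
qed

text \<open>The BMO side of the duality with H^1. With \<open>m\<close> the mean of \<open>b\<close>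
  over the ball, the localised function u = b - m has integral 0, so a suitable multiple of cnj u is
  an atom, and testing \<open>b\<close> against it returns the L^2 norm of u.\<close>

lemma H1_dual_oscillation:
  fixes b :: "real^'n \<Rightarrow> complex"
  assumes b: "b \<in> L2" and K: "\<And>a. a \<in> H1_atoms \<Longrightarrow> cmod (\<integral>x. a x * b x \<partial>gauss_measure) \<le> K"
    and adm: "admissible c r"
  obtains m where
    "L2_norm (\<lambda>x. indicator (ball c r) x * (b x - m)) \<le> K * sqrt (measure gauss_measure (ball c r))"
proof -
  let ?\<gamma> = "gauss_measure :: (real^'n) measure" and ?B = "ball c r"
  let ?g = "measure ?\<gamma> ?B"
  have pos: "0 < ?g" by (rule measure_ball_pos) (use adm in \<open>simp add: admissible_def\<close>)
  define m where "m = (\<integral>x. indicator ?B x * b x \<partial>?\<gamma>) / of_real ?g"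
  define u where "u x = indicator ?B x * (b x - m)" for x
  have const: "square_integrable ?\<gamma> (\<lambda>x. m)"
    by (rule gauss.square_integrable_bounded[of _ "cmod m"]) auto
  have u: "square_integrable ?\<gamma> u"
    unfolding u_def[abs_def] using b const
    by (intro square_integrable_indicator_mult square_integrable_diff) (simp_all add: L2_iff)
  then have cu: "square_integrable ?\<gamma> (\<lambda>x. cnj (u x))" by (rule square_integrable_cnj)
  have "(\<integral>x. u x \<partial>?\<gamma>) = (\<integral>x. indicator ?B x * b x - indicator ?B x * m \<partial>?\<gamma>)"
    by (simp add: u_def right_diff_distrib)
  also have "\<dots> = (\<integral>x. indicator ?B x * b x \<partial>?\<gamma>) - (\<integral>x. indicator ?B x * m \<partial>?\<gamma>)"
    using b const
    by (intro Bochner_Integration.integral_diff gauss.integrable_square_integrable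
        square_integrable_indicator_mult) (simp_all add: L2_iff)
  also have "(\<integral>x. indicator ?B x * m \<partial>?\<gamma>) = (\<integral>x. indicat_real ?B x *\<^sub>R m \<partial>?\<gamma>)"
    by (intro Bochner_Integration.integral_cong) (auto simp: indicator_def)
  also have "\<dots> = ?g *\<^sub>R m"
    by (subst integral_scaleR_left) (simp_all add: gauss.emeasure_eq_measure)
  also have "(\<integral>x. indicator ?B x * b x \<partial>?\<gamma>) - ?g *\<^sub>R m = 0"
    using pos by (simp add: m_def scaleR_conv_of_real)
  finally have mean: "(\<integral>x. u x \<partial>?\<gamma>) = 0" .
  then have cmean: "(\<integral>x. cnj (u x) \<partial>?\<gamma>) = 0"
    by simp
  \<comment> \<open>On the ball b = u + m, and the part with \<open>m\<close> drops out because cnj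
    u has integral 0.\<close>
  have "(\<integral>x. cnj (u x) * b x \<partial>?\<gamma>) = (\<integral>x. of_real ((cmod (u x))\<^sup>2) + m * cnj (u x) \<partial>?\<gamma>)"
  proof (rule Bochner_Integration.integral_cong)
    fix x
    show "cnj (u x) * b x = of_real ((cmod (u x))\<^sup>2) + m * cnj (u x)"
      unfolding complex_norm_square by (simp add: u_def indicator_def algebra_simps)
  qed simp
  also have "\<dots> = (\<integral>x. complex_of_real ((cmod (u x))\<^sup>2) \<partial>?\<gamma>) + (\<integral>x. m * cnj (u x) \<partial>?\<gamma>)"
    using u gauss.integrable_square_integrable[OF cu]
    by (intro Bochner_Integration.integral_add integrable_of_real integrable_mult_right)
       (auto simp: square_integrable_def)
  also have "\<dots> = of_real ((L2_norm u)\<^sup>2)"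
    unfolding L2_norm_eq norm2_power2 integral_complex_of_real integral_mult_right_zero cmean by simp
  finally have self: "(\<integral>x. cnj (u x) * b x \<partial>?\<gamma>) = of_real ((L2_norm u)\<^sup>2)" .
  \<comment> \<open>The constant function 1 is an atom, so \<open>K\<close> bounds at least one
    modulus.\<close>
  have "0 \<le> K" using order_trans[OF norm_ge_zero K[of "\<lambda>x. 1"]] by (simp add: H1_atoms_def)
  have "L2_norm u \<le> K * sqrt ?g"
  proof (rule oscillation_bound_aux[OF _ pos \<open>0 \<le> K\<close> self])
    show "u \<in> L2" using u by (simp add: L2_iff)
    fix s assume le: "L2_norm (\<lambda>x. s * cnj (u x)) \<le> ?g powr (- 1 / 2)"
    have "(\<lambda>x. s * cnj (u x)) \<in> L2"
      unfolding L2_iff by (rule square_integrable_cmult[OF cu])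
    moreover have "supported_in (\<lambda>x. s * cnj (u x)) ?B"
      unfolding supported_in_def by (simp add: u_def)
    moreover have "(\<integral>x. s * cnj (u x) \<partial>?\<gamma>) = 0"
      using cmean by simp
    ultimately have "(\<lambda>x. s * cnj (u x)) \<in> H1_atoms"
      unfolding H1_atoms_def using adm le L2_subset_L1 by blast
    from K[OF this] show "cmod (\<integral>x. s * cnj (u x) * b x \<partial>?\<gamma>) \<le> K" .
  qed
  then show ?thesis using that by (simp add: u_def[abs_def])
qed

text \<open>Global atoms need no cancellation, so \<open>b\<close> itself can be tested without
  subtracting a mean: on maximal balls not only the oscillation but the size of \<open>b\<close> is
  controlled.\<close>

lemma global_dual_bound:
  fixes b :: "real^'n \<Rightarrow> complex"
  assumes b: "b \<in> L2" and K: "\<And>a. a \<in> global_atoms \<Longrightarrow> cmod (\<integral>x. a x * b x \<partial>gauss_measure) \<le> K"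
    and "0 \<le> K"
  shows "L2_norm (\<lambda>x. indicator (ball c (max_radius c)) x * b x) \<le>
         K * sqrt (measure gauss_measure (ball c (max_radius c)))"
proof -
  let ?\<gamma> = "gauss_measure :: (real^'n) measure" and ?B = "ball c (max_radius c)"
  let ?g = "measure ?\<gamma> ?B"
  have pos: "0 < ?g" by (rule measure_ball_pos[OF max_radius_pos])
  define u where "u x = indicator ?B x * b x" for x
  have u: "square_integrable ?\<gamma> u"
    unfolding u_def[abs_def] using b by (intro square_integrable_indicator_mult) (simp_all add: L2_iff)
  then have cu: "square_integrable ?\<gamma> (\<lambda>x. cnj (u x))" by (rule square_integrable_cnj)
  have "(\<integral>x. cnj (u x) * b x \<partial>?\<gamma>) = (\<integral>x. complex_of_real ((cmod (u x))\<^sup>2) \<partial>?\<gamma>)"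
  proof (rule Bochner_Integration.integral_cong)
    fix x
    show "cnj (u x) * b x = of_real ((cmod (u x))\<^sup>2)"
      unfolding complex_norm_square by (simp add: u_def indicator_def)
  qed simp
  also have "\<dots> = of_real ((L2_norm u)\<^sup>2)"
    unfolding L2_norm_eq norm2_power2 by (rule integral_complex_of_real)
  finally have self: "(\<integral>x. cnj (u x) * b x \<partial>?\<gamma>) = of_real ((L2_norm u)\<^sup>2)" .
  have "L2_norm u \<le> K * sqrt ?g"
  proof (rule oscillation_bound_aux[OF _ pos \<open>0 \<le> K\<close> self])
    show "u \<in> L2" using u by (simp add: L2_iff)
    fix s assume le: "L2_norm (\<lambda>x. s * cnj (u x)) \<le> ?g powr (- 1 / 2)"
    have "(\<lambda>x. s * cnj (u x)) \<in> L2"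
      unfolding L2_iff by (rule square_integrable_cmult[OF cu])
    moreover have "supported_in (\<lambda>x. s * cnj (u x)) ?B"
      unfolding supported_in_def by (simp add: u_def)
    ultimately have "(\<lambda>x. s * cnj (u x)) \<in> global_atoms"
      unfolding global_atoms_def using le by blast
    from K[OF this] show "cmod (\<integral>x. s * cnj (u x) * b x \<partial>?\<gamma>) \<le> K" .
  qed
  then show ?thesis by (simp add: u_def[abs_def])
qed

text \<open>The point is that the bound does not depend on \<open>s\<close>. It passes through the
  oscillation of \<open>b\<close> rather than through its pairing with the given atom, because
  truncation respects the former and not the latter.\<close>

lemma truncation_pairing_bound:
  fixes b :: "real^'n \<Rightarrow> complex"
  assumes b: "b \<in> L2" and s: "0 \<le> s"
    and K: "\<And>a. a \<in> local_h1_atoms \<Longrightarrow> cmod (\<integral>x. a x * b x \<partial>gauss_measure) \<le> K"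
    and a: "a \<in> local_h1_atoms"
  shows "cmod (\<integral>x. a x * truncation s (b x) \<partial>gauss_measure) \<le> max K (L1_norm b)"
proof -
  let ?\<gamma> = "gauss_measure :: (real^'n) measure"
  have K0: "0 \<le> K" using order_trans[OF norm_ge_zero K[OF a]] .
  have bm: "b \<in> borel_measurable ?\<gamma>" using b by (simp add: L2_def)
  have tm: "(\<lambda>x. truncation s (b x)) \<in> borel_measurable ?\<gamma>"
    by (rule borel_measurable_truncation[OF s bm])
  have t: "square_integrable ?\<gamma> (\<lambda>x. truncation s (b x))"
    by (rule gauss.square_integrable_bounded[OF tm norm_truncation_le[OF s]])
  \<comment> \<open>Covers both kinds of localised atoms: subtracting \<open>truncation s m\<close>
    changes nothing, either because \<open>a\<close> has integral 0 or because m = 0 and 0 is fixed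
    by truncation. Then Cauchy-Schwarz on the ball gives \<open>K\<close>.\<close>
  have main: "cmod (\<integral>x. a x * truncation s (b x) \<partial>?\<gamma>) \<le> K"
    if aL2: "a \<in> L2" and supp: "supported_in a (ball c r)" and r: "0 < r"
      and le: "L2_norm a \<le> measure ?\<gamma> (ball c r) powr (- 1 / 2)"
      and m: "L2_norm (\<lambda>x. indicator (ball c r) x * (b x - m)) \<le> K * sqrt (measure ?\<gamma> (ball c r))"
      and mean: "m = 0 \<or> (\<integral>x. a x \<partial>?\<gamma>) = 0" for c r m
  proof -
    let ?B = "ball c r"
    note pos = measure_ball_pos[OF r, of c]
    let ?v = "\<lambda>x. indicator ?B x * (truncation s (b x) - truncation s m)"
    have const: "square_integrable ?\<gamma> (\<lambda>x. d)" for d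
      by (rule gauss.square_integrable_bounded[of _ "cmod d"]) auto
    have v: "square_integrable ?\<gamma> ?v"
      by (intro square_integrable_indicator_mult square_integrable_diff t const) simp
    have bv: "square_integrable ?\<gamma> (\<lambda>x. indicator ?B x * (b x - m))"
      using b by (intro square_integrable_indicator_mult square_integrable_diff const) (simp_all add: L2_iff)
    have "L2_norm ?v \<le> L2_norm (\<lambda>x. indicator ?B x * (b x - m))"
      unfolding L2_norm_eq
    proof (rule norm2_mono(2)[OF bv])
      show "?v \<in> borel_measurable ?\<gamma>" using v by (simp add: square_integrable_def)
    qed (simp add: norm_mult mult_left_mono truncation_lipschitz[OF s])
    then have v_le: "L2_norm ?v \<le> K * sqrt (measure ?\<gamma> ?B)" using m by linarith
    have sa: "square_integrable ?\<gamma> a" using aL2 by (simp add: L2_iff)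
    have "truncation s m * (\<integral>x. a x \<partial>?\<gamma>) = 0"
      using mean s by (auto simp: truncation_eq)
    then have "(\<integral>x. a x * truncation s (b x) \<partial>?\<gamma>) =
          (\<integral>x. a x * truncation s (b x) \<partial>?\<gamma>) - (\<integral>x. truncation s m * a x \<partial>?\<gamma>)"
      by simp
    also have "\<dots> = (\<integral>x. a x * truncation s (b x) - truncation s m * a x \<partial>?\<gamma>)"
      using square_integrable_mult[OF sa t] gauss.integrable_square_integrable[OF sa]
      by (intro Bochner_Integration.integral_diff[symmetric] integrable_mult_right)
    also have "\<dots> = (\<integral>x. a x * ?v x \<partial>?\<gamma>)"
    proof (rule integral_cong_AE)
      show "AE x in ?\<gamma>. a x * truncation s (b x) - truncation s m * a x = a x * ?v x"
        using supp unfolding supported_in_def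
        by eventually_elim (auto simp: indicator_def algebra_simps)
      show "(\<lambda>x. a x * truncation s (b x) - truncation s m * a x) \<in> borel_measurable ?\<gamma>"
        using square_integrable_mult[OF sa t] gauss.integrable_square_integrable[OF sa]
        by (intro borel_measurable_diff borel_measurable_integrable integrable_mult_right)
      show "(\<lambda>x. a x * ?v x) \<in> borel_measurable ?\<gamma>"
        using square_integrable_mult[OF sa v] by (rule borel_measurable_integrable)
    qed
    also have "cmod \<dots> \<le> L2_norm a * L2_norm ?v"
      unfolding L2_norm_eq by (rule norm_integral_mult_le[OF sa v])
    also have "\<dots> \<le> 1 / sqrt (measure ?\<gamma> ?B) * (K * sqrt (measure ?\<gamma> ?B))"
      using le unfolding powr_minus_half[OF pos]
      by (intro mult_mono v_le) (auto simp: L2_norm_eq norm2_nonneg)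
    also have "\<dots> = K" using pos by simp
    finally show ?thesis .
  qed
  consider "a = (\<lambda>x. 1)" | "a \<in> H1_atoms" "a \<noteq> (\<lambda>x. 1)" | "a \<in> global_atoms"
    using a by (auto simp: local_h1_atoms_def)
  then show ?thesis
  proof cases
    \<comment> \<open>The constant atom has no ball on which to measure oscillation; truncation does
      not increase moduli, so the L^1 norm of \<open>b\<close> serves as bound.\<close>
    case 1
    have "cmod (\<integral>x. a x * truncation s (b x) \<partial>?\<gamma>) \<le> (\<integral>x. cmod (truncation s (b x)) \<partial>?\<gamma>)"
      unfolding 1 using integral_norm_bound[of ?\<gamma> "\<lambda>x. truncation s (b x)"] by simp
    also have "\<dots> \<le> L1_norm b"
      unfolding L1_norm_def
      using gauss.integrable_square_integrable[OF t] L2_subset_L1[OF b] norm_truncation_le_norm[OF s]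
      by (intro integral_mono) (auto simp: L1_def)
    finally show ?thesis by simp
  next
    case 2
    then obtain c r where adm: "admissible c r" and *: "supported_in a (ball c r)" "a \<in> L2"
      "L2_norm a \<le> measure ?\<gamma> (ball c r) powr (- 1 / 2)" "(\<integral>x. a x \<partial>?\<gamma>) = 0"
      unfolding H1_atoms_def by blast
    obtain m where "L2_norm (\<lambda>x. indicator (ball c r) x * (b x - m)) \<le> K * sqrt (measure ?\<gamma> (ball c r))"
      using H1_dual_oscillation[OF b _ adm, of K] K unfolding local_h1_atoms_def by blast
    then show ?thesis using main[of c r m] * adm by (simp add: admissible_def)
  next
    case 3
    then obtain c where *: "supported_in a (ball c (max_radius c))" "a \<in> L2"
      "L2_norm a \<le> measure ?\<gamma> (ball c (max_radius c)) powr (- 1 / 2)"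
      unfolding global_atoms_def by blast
    have "L2_norm (\<lambda>x. indicator (ball c (max_radius c)) x * b x) \<le>
         K * sqrt (measure gauss_measure (ball c (max_radius c)))"
      using K by (intro global_dual_bound[OF b _ K0]) (auto simp: local_h1_atoms_def)
    then show ?thesis using main[of c "max_radius c" 0] * max_radius_pos[of c] by simp
  qed
qed

text \<open>Two limits are interchanged. At a fixed height the truncation is bounded, and the L^1
  convergence of the partial sums to 0 gives a vanishing series. The height then tends to infinity,
  first inside each integral and then under the sum over j.\<close>

lemma atomic_series_pairing_zero:
  fixes b :: "real^'n \<Rightarrow> complex"
  assumes dec: "atomic_decomposition local_h1_atoms (\<lambda>x. 0) lam a"
    and b: "b \<in> L2"
    and K: "\<And>a. a \<in> local_h1_atoms \<Longrightarrow> cmod (\<integral>x. a x * b x \<partial>gauss_measure) \<le> K"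
  shows "(\<lambda>j. lam j * (\<integral>x. a j x * b x \<partial>gauss_measure)) sums 0"
proof -
  let ?\<gamma> = "gauss_measure :: (real^'n) measure"
  have a: "\<And>j. a j \<in> local_h1_atoms" and lam: "summable (\<lambda>j. cmod (lam j))"
    and lim: "(\<lambda>N. L1_norm (\<lambda>x. 0 - (\<Sum>j<N. lam j * a j x))) \<longlonglongrightarrow> 0"
    using dec unfolding atomic_decomposition_def by auto
  have aL2: "a j \<in> L2" for j using a local_h1_atoms_subset_L2 by blast
  have aL1: "integrable ?\<gamma> (a j)" for j using L2_subset_L1[OF aL2] by (simp add: L1_def)
  have bm: "b \<in> borel_measurable ?\<gamma>" using b by (simp add: L2_def)
  have ab: "integrable ?\<gamma> (\<lambda>x. a j x * b x)" for j
    using aL2 b by (intro square_integrable_mult) (simp_all add: L2_iff)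
  define t where "t n x = truncation (real n) (b x)" for n x
  have tm: "t n \<in> borel_measurable ?\<gamma>" for n
    unfolding t_def[abs_def] by (rule borel_measurable_truncation[OF _ bm]) simp
  have t2: "square_integrable ?\<gamma> (t n)" for n
    by (rule gauss.square_integrable_bounded[OF tm, of n "real n"]) (simp add: t_def norm_truncation_le)
  have at: "integrable ?\<gamma> (\<lambda>x. a j x * t n x)" for j n
    using aL2 t2 by (intro square_integrable_mult) (simp_all add: L2_iff)
  define c where "c j n = lam j * (\<integral>x. a j x * t n x \<partial>?\<gamma>)" for j n
  define M where "M = max K (L1_norm b)"
  have c_le: "norm (c j n) \<le> cmod (lam j) * M" for j n
    unfolding c_def norm_mult M_def t_def
    by (intro mult_left_mono truncation_pairing_bound b K a) simp_all
  have sumM: "summable (\<lambda>j. cmod (lam j) * M)" by (rule summable_mult2[OF lam])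
  have zero: "(\<lambda>j. c j n) sums 0" for n
    unfolding sums_def
  proof (rule Lim_null_comparison[OF always_eventually, rule_format])
    have "(\<lambda>N. real n * L1_norm (\<lambda>x. 0 - (\<Sum>j<N. lam j * a j x))) \<longlonglongrightarrow> real n * 0"
      by (intro tendsto_mult_left lim)
    then show "(\<lambda>N. real n * L1_norm (\<lambda>x. 0 - (\<Sum>j<N. lam j * a j x))) \<longlonglongrightarrow> 0" by simp
    fix N
    have intN: "integrable ?\<gamma> (\<lambda>x. \<Sum>j<N. lam j * a j x)"
      by (intro Bochner_Integration.integrable_sum integrable_mult_right aL1)
    have "(\<Sum>j<N. c j n) = (\<integral>x. (\<Sum>j<N. lam j * (a j x * t n x)) \<partial>?\<gamma>)"
      unfolding c_def using at
      by (subst Bochner_Integration.integral_sum) (simp_all only: integrable_mult_right integral_mult_right_zero)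
    also have "\<dots> = (\<integral>x. (\<Sum>j<N. lam j * a j x) * t n x \<partial>?\<gamma>)"
      by (simp add: sum_distrib_right mult.assoc)
    also have "norm \<dots> \<le> (\<integral>x. cmod ((\<Sum>j<N. lam j * a j x) * t n x) \<partial>?\<gamma>)"
      by (rule integral_norm_bound)
    also have "\<dots> \<le> (\<integral>x. real n * cmod (\<Sum>j<N. lam j * a j x) \<partial>?\<gamma>)"
    proof (rule integral_mono)
      have "integrable ?\<gamma> (\<lambda>x. \<Sum>j<N. lam j * (a j x * t n x))"
        by (intro Bochner_Integration.integrable_sum integrable_mult_right at)
      then show "integrable ?\<gamma> (\<lambda>x. cmod ((\<Sum>j<N. lam j * a j x) * t n x))"
        by (intro integrable_norm) (simp add: sum_distrib_right mult.assoc)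
      show "integrable ?\<gamma> (\<lambda>x. real n * cmod (\<Sum>j<N. lam j * a j x))"
        by (intro integrable_mult_right integrable_norm intN)
      show "cmod ((\<Sum>j<N. lam j * a j x) * t n x) \<le> real n * cmod (\<Sum>j<N. lam j * a j x)" for x
        unfolding norm_mult t_def using norm_truncation_le[of "real n" "b x"]
        by (subst mult.commute) (rule mult_right_mono, simp_all)
    qed
    also have "\<dots> = real n * L1_norm (\<lambda>x. 0 - (\<Sum>j<N. lam j * a j x))"
      by (simp add: L1_norm_def norm_minus_cancel)
    finally show "norm (\<Sum>j<N. c j n) \<le> real n * L1_norm (\<lambda>x. 0 - (\<Sum>j<N. lam j * a j x))" .
  qed
  have conv: "(\<lambda>n. c j n) \<longlonglongrightarrow> lam j * (\<integral>x. a j x * b x \<partial>?\<gamma>)" for j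
    unfolding c_def
  proof (intro tendsto_mult_left integral_dominated_convergence[where w="\<lambda>x. cmod (a j x * b x)"])
    show "AE x in ?\<gamma>. (\<lambda>n. a j x * t n x) \<longlonglongrightarrow> a j x * b x"
    proof (intro AE_I2 tendsto_mult_left tendsto_eventually)
      fix x
      have "\<forall>\<^sub>F n in sequentially. cmod (b x) \<le> real n"
        using filterlim_real_sequentially by (simp add: filterlim_at_top)
      then show "\<forall>\<^sub>F n in sequentially. t n x = b x"
        by eventually_elim (simp add: t_def truncation_eq)
    qed
    show "AE x in ?\<gamma>. norm (a j x * t n x) \<le> cmod (a j x * b x)" for n
      by (simp add: norm_mult t_def mult_left_mono norm_truncation_le_norm)
  qed (use ab at in auto)
  \<comment> \<open>Tannery's theorem is dominated convergence for series; the majorant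
    \<open>cmod (lam j) * M\<close> is independent of the truncation height by
    \<open>truncation_pairing_bound\<close>.\<close>
  have "summable (\<lambda>j. norm (lam j * (\<integral>x. a j x * b x \<partial>?\<gamma>))) \<and>
        (\<lambda>n. \<Sum>j. c j n) \<longlonglongrightarrow> (\<Sum>j. lam j * (\<integral>x. a j x * b x \<partial>?\<gamma>))"
    using tannerys_theorem[of c "\<lambda>j. lam j * (\<integral>x. a j x * b x \<partial>?\<gamma>)" sequentially "\<lambda>j. cmod (lam j) * M",
        OF conv _ sumM] c_le
    by (auto intro: always_eventually)
  moreover have "(\<Sum>j. c j n) = 0" for n using sums_unique[OF zero] by simp
  ultimately have s: "summable (\<lambda>j. norm (lam j * (\<integral>x. a j x * b x \<partial>?\<gamma>)))"
    and "(\<lambda>n. 0) \<longlonglongrightarrow> (\<Sum>j. lam j * (\<integral>x. a j x * b x \<partial>?\<gamma>))" by auto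
  then have "(\<Sum>j. lam j * (\<integral>x. a j x * b x \<partial>?\<gamma>)) = 0"
    by (simp add: LIMSEQ_const_iff)
  then show ?thesis
    using summable_sums[OF summable_norm_cancel[OF s]] by simp
qed

text \<open>One well-chosen functional suffices: with p = cnj (sgn g), the integral of p g is the
  L^1 norm of \<open>g\<close>. Transposing \<open>T\<close> in the pairing with p gives a
  \<open>b\<close> whose pairings with atoms are at most \<open>K\<close>, so the series of pairings
  sums to 0.\<close>

lemma atomic_series_image_zero:
  fixes T :: "(real^'n \<Rightarrow> complex) \<Rightarrow> (real^'n \<Rightarrow> complex)"
  assumes T: "bounded_linear_operator_on_L2 T"
    and K: "\<And>a. a \<in> local_h1_atoms \<Longrightarrow> L1_norm (T a) \<le> K"
    and dec: "atomic_decomposition local_h1_atoms (\<lambda>x. 0) lam a"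
    and g: "g \<in> L1" "(\<lambda>N. L1_norm (\<lambda>x. g x - (\<Sum>j<N. lam j * T (a j) x))) \<longlonglongrightarrow> 0"
  shows "AE x in gauss_measure. g x = 0"
proof -
  let ?\<gamma> = "gauss_measure :: (real^'n) measure"
  note TL2 = bounded_linear_operator_on_L2D(1)[OF T]
  have aL2: "a j \<in> L2" for j
    using dec local_h1_atoms_subset_L2 unfolding atomic_decomposition_def by blast
  have gi: "integrable ?\<gamma> g" using g(1) by (simp add: L1_def)
  then have gm: "g \<in> borel_measurable ?\<gamma>" by auto
  define p where "p x = cnj (sgn (g x))" for x
  have "(\<lambda>z::complex. cnj (sgn z)) \<in> borel_measurable borel"
    by (intro borel_measurable_continuous_on[of cnj] continuous_intros) simp
  from measurable_compose[OF gm this] have pm: "p \<in> borel_measurable ?\<gamma>"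
    unfolding p_def[abs_def] .
  have p1: "cmod (p x) \<le> 1" for x by (simp add: p_def norm_sgn)
  have pint: "integrable ?\<gamma> (\<lambda>x. p x * h x)" if "integrable ?\<gamma> h" for h
    by (rule Bochner_Integration.integrable_bound[OF that])
       (use pm p1 that in \<open>auto simp: norm_mult intro!: mult_left_le_one_le\<close>)
  have ple: "cmod (\<integral>x. p x * h x \<partial>?\<gamma>) \<le> L1_norm h" if "integrable ?\<gamma> h" for h
  proof -
    have "cmod (\<integral>x. p x * h x \<partial>?\<gamma>) \<le> (\<integral>x. cmod (p x * h x) \<partial>?\<gamma>)"
      by (rule integral_norm_bound)
    also have "\<dots> \<le> L1_norm h"
      unfolding L1_norm_def using p1
      by (intro integral_mono integrable_norm pint that) (simp add: norm_mult mult_left_le_one_le)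
    finally show ?thesis .
  qed
  obtain b where b: "b \<in> L2"
    and pb: "\<And>f. f \<in> L2 \<Longrightarrow> (\<integral>x. p x * T f x \<partial>?\<gamma>) = (\<integral>x. f x * b x \<partial>?\<gamma>)"
    using operator_pairing_representation[OF T, of p] pm p1 by auto
  have Ti: "integrable ?\<gamma> (T f)" if "f \<in> L2" for f
    using L2_subset_L1[OF TL2[OF that]] by (simp add: L1_def)
  have "cmod (\<integral>x. f x * b x \<partial>?\<gamma>) \<le> K" if f: "f \<in> local_h1_atoms" for f
  proof -
    have "f \<in> L2" using f local_h1_atoms_subset_L2 by blast
    then show ?thesis using ple[OF Ti[of f]] K[OF f] pb[of f] by simp
  qed
  from atomic_series_pairing_zero[OF dec b this]
  have "(\<lambda>N. \<Sum>j<N. lam j * (\<integral>x. p x * T (a j) x \<partial>?\<gamma>)) \<longlonglongrightarrow> 0"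
    unfolding sums_def pb[OF aL2] .
  moreover have "(\<lambda>N. \<Sum>j<N. lam j * (\<integral>x. p x * T (a j) x \<partial>?\<gamma>)) \<longlonglongrightarrow> (\<integral>x. p x * g x \<partial>?\<gamma>)"
  proof (rule LIM_zero_cancel, rule Lim_null_comparison[OF always_eventually g(2), rule_format])
    fix N
    have sN: "integrable ?\<gamma> (\<lambda>x. \<Sum>j<N. lam j * T (a j) x)"
      by (intro Bochner_Integration.integrable_sum integrable_mult_right Ti aL2)
    have "(\<Sum>j<N. lam j * (\<integral>x. p x * T (a j) x \<partial>?\<gamma>)) =
          (\<integral>x. (\<Sum>j<N. lam j * (p x * T (a j) x)) \<partial>?\<gamma>)"
      using pint[OF Ti[OF aL2]]
      by (subst Bochner_Integration.integral_sum) (simp_all only: integrable_mult_right integral_mult_right_zero)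
    also have "\<dots> = (\<integral>x. p x * (\<Sum>j<N. lam j * T (a j) x) \<partial>?\<gamma>)"
      by (simp add: sum_distrib_left mult_ac)
    finally have "(\<integral>x. p x * g x \<partial>?\<gamma>) - (\<Sum>j<N. lam j * (\<integral>x. p x * T (a j) x \<partial>?\<gamma>)) =
        (\<integral>x. p x * (g x - (\<Sum>j<N. lam j * T (a j) x)) \<partial>?\<gamma>)"
      using pint[OF gi] pint[OF sN] by (simp add: right_diff_distrib)
    then show "norm ((\<Sum>j<N. lam j * (\<integral>x. p x * T (a j) x \<partial>?\<gamma>)) - (\<integral>x. p x * g x \<partial>?\<gamma>))
        \<le> L1_norm (\<lambda>x. g x - (\<Sum>j<N. lam j * T (a j) x))"
      using ple[OF Bochner_Integration.integrable_diff[OF gi sN]] by (simp add: norm_minus_commute)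
  qed
  ultimately have "(\<integral>x. p x * g x \<partial>?\<gamma>) = 0" by (rule LIMSEQ_unique[symmetric])
  moreover have "p x * g x = complex_of_real (cmod (g x))" for x
    by (simp add: p_def sgn_div_norm complex_norm_square[symmetric] power2_eq_square scaleR_conv_of_real
        mult.commute field_simps)
  ultimately have "(\<integral>x. cmod (g x) \<partial>?\<gamma>) = 0" by simp
  then show ?thesis
    using integral_nonneg_eq_0_iff_AE[OF integrable_norm[OF gi]] by simp
qed

subsection \<open>Extension to the atomic space\<close>

lemma sum_interleave:
  fixes u v :: "nat \<Rightarrow> 'a::comm_monoid_add"
  shows "(\<Sum>j<N. if even j then u (j div 2) else v (j div 2)) =
         (\<Sum>j<(N + 1) div 2. u j) + (\<Sum>j<N div 2. v j)"
proof (induction N)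
  case (Suc N)
  show ?case
  proof (cases "even N")
    case True
    then obtain m where "N = 2 * m" by (elim evenE)
    then show ?thesis using Suc.IH by (simp add: add_ac)
  next
    case False
    then obtain m where "N = 2 * m + 1" by (elim oddE)
    then show ?thesis using Suc.IH by (simp add: add_ac)
  qed
qed simp

text \<open>A combination of two series has to be presented as a single sequence. Up to
  \<open>N\<close> the interleaved one contains (N + 1) div 2 terms of the first series and N div 2
  of the second, and both counts tend to infinity. Used once for atoms and once for their
  images.\<close>

lemma L1_norm_interleave:
  fixes f g :: "real^'n \<Rightarrow> complex"
  assumes f: "f \<in> L1" "\<And>j. u j \<in> L1" and g: "g \<in> L1" "\<And>j. v j \<in> L1"
    and limf: "(\<lambda>N. L1_norm (\<lambda>x. f x - (\<Sum>j<N. lam j * u j x))) \<longlonglongrightarrow> 0"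
    and limg: "(\<lambda>N. L1_norm (\<lambda>x. g x - (\<Sum>j<N. mu j * v j x))) \<longlonglongrightarrow> 0"
  shows "(\<lambda>N. L1_norm (\<lambda>x. \<alpha> * f x + \<beta> * g x -
             (\<Sum>j<N. (if even j then \<alpha> * lam (j div 2) else \<beta> * mu (j div 2)) *
                      (if even j then u (j div 2) else v (j div 2)) x))) \<longlonglongrightarrow> 0"
proof (rule Lim_null_comparison[OF always_eventually, rule_format])
  let ?F = "\<lambda>N x. f x - (\<Sum>j<N. lam j * u j x)" and ?G = "\<lambda>N x. g x - (\<Sum>j<N. mu j * v j x)"
  have half: "filterlim (\<lambda>N::nat. (N + i) div 2) at_top sequentially" for i
    unfolding filterlim_at_top eventually_sequentially
  proof
    fix Z
    show "\<exists>N. \<forall>n\<ge>N. Z \<le> (n + i) div 2" by (intro exI[of _ "2 * Z"]) auto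
  qed
  have "(\<lambda>N. cmod \<alpha> * L1_norm (?F ((N + 1) div 2)) + cmod \<beta> * L1_norm (?G ((N + 0) div 2)))
      \<longlonglongrightarrow> cmod \<alpha> * 0 + cmod \<beta> * 0"
    by (intro tendsto_add tendsto_mult_left filterlim_compose[OF limf half] filterlim_compose[OF limg half])
  then show "(\<lambda>N. cmod \<alpha> * L1_norm (?F ((N + 1) div 2)) + cmod \<beta> * L1_norm (?G (N div 2))) \<longlonglongrightarrow> 0"
    by simp
  fix N
  have L1F: "(\<lambda>x. \<alpha> * ?F n x) \<in> L1" for n
    using f unfolding L1_def by auto
  have L1G: "(\<lambda>x. \<beta> * ?G n x) \<in> L1" for n
    using g unfolding L1_def by auto
  have "(\<Sum>j<N. (if even j then \<alpha> * lam (j div 2) else \<beta> * mu (j div 2)) *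
                      (if even j then u (j div 2) else v (j div 2)) x) =
        (\<Sum>j<N. if even j then (\<lambda>i. \<alpha> * (lam i * u i x)) (j div 2) else (\<lambda>i. \<beta> * (mu i * v i x)) (j div 2))" for x
    by (intro sum.cong) (auto simp: mult.assoc)
  also have "\<dots> x = \<alpha> * (\<Sum>j<(N + 1) div 2. lam j * u j x) + \<beta> * (\<Sum>j<N div 2. mu j * v j x)" for x
    using sum_interleave[of "\<lambda>i. \<alpha> * (lam i * u i x)" "\<lambda>i. \<beta> * (mu i * v i x)" N]
    by (simp add: sum_distrib_left)
  finally have "L1_norm (\<lambda>x. \<alpha> * f x + \<beta> * g x -
             (\<Sum>j<N. (if even j then \<alpha> * lam (j div 2) else \<beta> * mu (j div 2)) *
                      (if even j then u (j div 2) else v (j div 2)) x)) =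
        L1_norm (\<lambda>x. \<alpha> * ?F ((N + 1) div 2) x + \<beta> * ?G (N div 2) x)"
    by (simp add: algebra_simps)
  also have "\<dots> \<le> cmod \<alpha> * L1_norm (?F ((N + 1) div 2)) + cmod \<beta> * L1_norm (?G (N div 2))"
    using L1_norm_triangle[OF L1F L1G] unfolding L1_norm_cmult .
  finally show "norm (L1_norm (\<lambda>x. \<alpha> * f x + \<beta> * g x -
             (\<Sum>j<N. (if even j then \<alpha> * lam (j div 2) else \<beta> * mu (j div 2)) *
                      (if even j then u (j div 2) else v (j div 2)) x))) \<le>
      cmod \<alpha> * L1_norm (?F ((N + 1) div 2)) + cmod \<beta> * L1_norm (?G (N div 2))"
    by (simp add: L1_norm_nonneg)
qed

lemma summable_interleave:
  fixes u v :: "nat \<Rightarrow> real"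
  assumes "summable u" "summable v"
  shows "summable (\<lambda>j. if even j then u (j div 2) else v (j div 2))"
proof -
  have "(\<lambda>j. if even j then u (j div 2) else v ((j - 1) div 2)) sums (suminf v + suminf u)"
    by (intro sums_if summable_sums assms)
  \<comment> \<open>\<open>sums_if\<close> indexes the odd terms by (j - 1) div 2, which for odd j
    equals j div 2.\<close>
  also have "(\<lambda>j. if even j then u (j div 2) else v ((j - 1) div 2)) =
             (\<lambda>j. if even j then u (j div 2) else v (j div 2))"
    by (rule ext) (auto elim!: oddE)
  finally show ?thesis by (rule sums_summable)
qed

text \<open>The graph of the intended extension, as a relation. The decomposition of
  \<open>f\<close> is existentially quantified, so a priori one \<open>f\<close> may have several
  images; single-valuedness up to null sets is \<open>atomic_image_unique\<close>.\<close>

definition atomic_image ::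
  "((real^'n \<Rightarrow> complex) \<Rightarrow> real^'n \<Rightarrow> complex) \<Rightarrow> (real^'n \<Rightarrow> complex) set \<Rightarrow>
   (real^'n \<Rightarrow> complex) \<Rightarrow> (real^'n \<Rightarrow> complex) \<Rightarrow> bool" where
  "atomic_image T A f g \<longleftrightarrow> f \<in> L1 \<and> g \<in> L1 \<and>
     (\<exists>lam a. atomic_decomposition A f lam a \<and>
        (\<lambda>N. L1_norm (\<lambda>x. g x - (\<Sum>j<N. lam j * T (a j) x))) \<longlonglongrightarrow> 0)"

lemma atomic_image_linear:
  assumes "atomic_image T A f f'" "atomic_image T A g g'"
    and A: "A \<subseteq> L1" and T: "\<And>a. a \<in> A \<Longrightarrow> T a \<in> L1"
  shows "atomic_image T A (\<lambda>x. \<alpha> * f x + \<beta> * g x) (\<lambda>x. \<alpha> * f' x + \<beta> * g' x)"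
proof -
  from assms(1) obtain lam a where f: "f \<in> L1" "f' \<in> L1" "atomic_decomposition A f lam a"
    "(\<lambda>N. L1_norm (\<lambda>x. f' x - (\<Sum>j<N. lam j * T (a j) x))) \<longlonglongrightarrow> 0"
    unfolding atomic_image_def by blast
  from assms(2) obtain mu b where g: "g \<in> L1" "g' \<in> L1" "atomic_decomposition A g mu b"
    "(\<lambda>N. L1_norm (\<lambda>x. g' x - (\<Sum>j<N. mu j * T (b j) x))) \<longlonglongrightarrow> 0"
    unfolding atomic_image_def by blast
  have aA: "a j \<in> A" "b j \<in> A" for j
    using f(3) g(3) by (auto simp: atomic_decomposition_def)
  then have L1: "a j \<in> L1" "b j \<in> L1" "T (a j) \<in> L1" "T (b j) \<in> L1" for j
    using A T by auto
  define nu where "nu j = (if even j then \<alpha> * lam (j div 2) else \<beta> * mu (j div 2))" for j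
  define e where "e j = (if even j then a (j div 2) else b (j div 2))" for j
  have "summable (\<lambda>j. if even j then cmod (\<alpha> * lam (j div 2)) else cmod (\<beta> * mu (j div 2)))"
    using f(3) g(3) unfolding atomic_decomposition_def norm_mult
    by (intro summable_interleave[of "\<lambda>i. cmod \<alpha> * cmod (lam i)" "\<lambda>i. cmod \<beta> * cmod (mu i)"] summable_mult)
       auto
  also have "(\<lambda>j. if even j then cmod (\<alpha> * lam (j div 2)) else cmod (\<beta> * mu (j div 2))) = (\<lambda>j. cmod (nu j))"
    by (auto simp: nu_def)
  finally have 1: "summable (\<lambda>j. cmod (nu j))" .
  have 2: "(\<lambda>N. L1_norm (\<lambda>x. \<alpha> * f x + \<beta> * g x - (\<Sum>j<N. nu j * e j x))) \<longlonglongrightarrow> 0"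
    unfolding nu_def e_def using f g unfolding atomic_decomposition_def
    by (intro L1_norm_interleave L1) auto
  have Te: "T (e j) = (if even j then T (a (j div 2)) else T (b (j div 2)))" for j
    by (simp add: e_def)
  have 3: "(\<lambda>N. L1_norm (\<lambda>x. \<alpha> * f' x + \<beta> * g' x - (\<Sum>j<N. nu j * T (e j) x))) \<longlonglongrightarrow> 0"
    unfolding nu_def Te
    by (intro L1_norm_interleave[of f' "\<lambda>j. T (a j)" g' "\<lambda>j. T (b j)"] L1 f g)
  have L1c: "(\<lambda>x. \<alpha> * h x + \<beta> * h' x) \<in> L1" if "h \<in> L1" "h' \<in> L1" for h h' :: "real^'n \<Rightarrow> complex"
    using that by (simp add: L1_def)
  have "e j \<in> A" for j using aA by (simp add: e_def)
  then show ?thesis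
    unfolding atomic_image_def atomic_decomposition_def
    using 1 2 3 L1c f g by blast
qed

text \<open>The image series converges absolutely in L^1. The norm bound refers to the given
  decomposition; passing to the infimum over decompositions additionally requires uniqueness of the
  image.\<close>

lemma atomic_image_exists:
  assumes dec: "atomic_decomposition A f lam a" and f: "f \<in> L1"
    and T: "\<And>a. a \<in> A \<Longrightarrow> T a \<in> L1" and K: "\<And>a. a \<in> A \<Longrightarrow> L1_norm (T a) \<le> K"
  obtains g where "atomic_image T A f g" "L1_norm g \<le> K * (\<Sum>j. cmod (lam j))"
proof -
  have a: "\<And>j. a j \<in> A" and lam: "summable (\<lambda>j. cmod (lam j))"
    using dec by (auto simp: atomic_decomposition_def)
  define u where "u j x = lam j * T (a j) x" for j x
  have ui: "integrable gauss_measure (u j)" for j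
    using T[OF a] unfolding u_def[abs_def] L1_def by simp
  have u_le: "L1_norm (u j) \<le> K * cmod (lam j)" for j
    unfolding u_def[abs_def] L1_norm_cmult
    using mult_left_mono[OF K[OF a] norm_ge_zero, of "lam j" j] by (simp add: mult.commute)
  have sumK: "summable (\<lambda>j. K * cmod (lam j))" by (rule summable_mult[OF lam])
  have sumu: "summable (\<lambda>j. L1_norm (u j))"
    by (rule summable_comparison_test'[OF sumK]) (use u_le in \<open>simp add: L1_norm_nonneg\<close>)
  define g where "g x = (\<Sum>j. u j x)" for x
  have g: "g \<in> L1" and lim: "(\<lambda>N. L1_norm (\<lambda>x. g x - (\<Sum>j<N. u j x))) \<longlonglongrightarrow> 0"
    using summable_integral_norm_imp(2,3)[OF ui sumu[unfolded L1_norm_def]]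
    by (simp_all add: L1_def L1_norm_def g_def[abs_def])
  show ?thesis
  proof
    show "atomic_image T A f g"
      unfolding atomic_image_def using f g dec lim unfolding u_def by blast
    have "L1_norm g \<le> L1_norm (\<lambda>x. g x - (\<Sum>j<N. u j x)) + K * (\<Sum>j. cmod (lam j))" for N
    proof -
      have sL1: "(\<lambda>x. \<Sum>j<N. u j x) \<in> L1" for N
        unfolding L1_def using ui by simp
      have "L1_norm (\<lambda>x. \<Sum>j<N. u j x) \<le> (\<Sum>j<N. L1_norm (u j))"
      proof (induction N)
        case (Suc N)
        have "L1_norm (\<lambda>x. (\<Sum>j<N. u j x) + u N x) \<le> L1_norm (\<lambda>x. \<Sum>j<N. u j x) + L1_norm (u N)"
          by (rule L1_norm_triangle[OF sL1]) (simp add: L1_def ui)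
        then show ?case using Suc.IH by simp
      qed (simp add: L1_norm_def)
      also have "\<dots> \<le> (\<Sum>j. L1_norm (u j))"
        by (rule sum_le_suminf[OF sumu]) (simp_all add: L1_norm_nonneg)
      also have "\<dots> \<le> (\<Sum>j. K * cmod (lam j))"
        by (rule suminf_le[OF u_le sumu sumK])
      also have "\<dots> = K * (\<Sum>j. cmod (lam j))" by (rule suminf_mult[OF lam])
      finally have le: "L1_norm (\<lambda>x. \<Sum>j<N. u j x) \<le> K * (\<Sum>j. cmod (lam j))" .
      have "(\<lambda>x. g x - (\<Sum>j<N. u j x)) \<in> L1" using g sL1 by (simp add: L1_def)
      from L1_norm_triangle[OF this sL1[of N]] le show ?thesis by simp
    qed
    then show "L1_norm g \<le> K * (\<Sum>j. cmod (lam j))"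
      using LIMSEQ_le_const[OF tendsto_add[OF lim tendsto_const]] by fastforce
  qed
qed

text \<open>By linearity of the relation, the difference of two images of \<open>f\<close> is an
  image of 0.\<close>

lemma atomic_image_unique:
  fixes T :: "(real^'n \<Rightarrow> complex) \<Rightarrow> (real^'n \<Rightarrow> complex)"
  assumes T: "bounded_linear_operator_on_L2 T"
    and K: "\<And>a. a \<in> local_h1_atoms \<Longrightarrow> L1_norm (T a) \<le> K"
    and g: "atomic_image T local_h1_atoms f g" and h: "atomic_image T local_h1_atoms f h"
  shows "AE x in gauss_measure. g x = h x"
proof -
  have "local_h1_atoms \<subseteq> (L1 :: (real^'n \<Rightarrow> complex) set)"
    using local_h1_atoms_subset_L2 L2_subset_L1 by blast
  moreover have "T a \<in> L1" if "a \<in> local_h1_atoms" for a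
    using that local_h1_atoms_subset_L2 L2_subset_L1 bounded_linear_operator_on_L2D(1)[OF T] by blast
  ultimately have "atomic_image T local_h1_atoms (\<lambda>x. 1 * f x + (-1) * f x) (\<lambda>x. 1 * g x + (-1) * h x)"
    by (rule atomic_image_linear[OF g h])
  then have "atomic_image T local_h1_atoms (\<lambda>x. 0) (\<lambda>x. g x - h x)" by simp
  then have "AE x in gauss_measure. g x - h x = 0"
    unfolding atomic_image_def using atomic_series_image_zero[OF T K] by blast
  then show ?thesis by simp
qed

section \<open>Finite combinations and the construction of the extension\<close>

lemma L2_sum:
  fixes N :: nat
  assumes "\<And>j. j < N \<Longrightarrow> a j \<in> L2"
  shows "(\<lambda>x. \<Sum>j<N. lam j * a j x) \<in> L2"
  using assms
proof (induction N)
  case (Suc N)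
  then have "(\<lambda>x. \<Sum>j<N. lam j * a j x) \<in> L2" "a N \<in> L2" by simp_all
  then show ?case
    by (simp add: L2_iff square_integrable_add square_integrable_cmult)
qed (simp add: L2_def)

lemma operator_finite_sum:
  fixes T :: "(real^'n \<Rightarrow> complex) \<Rightarrow> (real^'n \<Rightarrow> complex)" and N :: nat
  assumes T: "bounded_linear_operator_on_L2 T" and a: "\<And>j. j < N \<Longrightarrow> a j \<in> L2"
  shows "AE x in gauss_measure. T (\<lambda>z. \<Sum>j<N. lam j * a j z) x = (\<Sum>j<N. lam j * T (a j) x)"
  using a
proof (induction N)
  case 0
  have "(\<lambda>x. 0) \<in> (L2 :: (real^'n \<Rightarrow> complex) set)" by (simp add: L2_def)
  \<comment> \<open>Linearity with both coefficients 0 gives T 0 = 0 almost everywhere.\<close>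
  from bounded_linear_operator_on_L2D(2)[OF T this this, of 0 0] show ?case by simp
next
  case (Suc N)
  have "(\<lambda>z. \<Sum>j<N. lam j * a j z) \<in> L2" by (rule L2_sum) (simp add: Suc.prems)
  from bounded_linear_operator_on_L2D(2)[OF T this, of "a N" 1 "lam N"] Suc.prems
  have "AE x in gauss_measure. T (\<lambda>z. \<Sum>j<Suc N. lam j * a j z) x =
      T (\<lambda>z. \<Sum>j<N. lam j * a j z) x + lam N * T (a N) x"
    by simp
  moreover have "AE x in gauss_measure. T (\<lambda>z. \<Sum>j<N. lam j * a j z) x = (\<Sum>j<N. lam j * T (a j) x)"
    by (rule Suc.IH) (simp add: Suc.prems)
  ultimately show ?case by eventually_elim simp
qed

text \<open>This makes the extension agree with \<open>T\<close>. The finite sum is padded to an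
  infinite sequence by the atom 1 with coefficient 0, after which both remainders are eventually
  null.\<close>

lemma atomic_image_finite_combination:
  fixes T :: "(real^'n \<Rightarrow> complex) \<Rightarrow> (real^'n \<Rightarrow> complex)"
  assumes T: "bounded_linear_operator_on_L2 T" and f: "f \<in> finite_combinations local_h1_atoms"
  shows "atomic_image T local_h1_atoms f (T f)"
proof -
  obtain N :: nat and lam a where f_eq: "f = (\<lambda>x. \<Sum>j<N. lam j * a j x)"
    and a: "\<And>j. j < N \<Longrightarrow> a j \<in> local_h1_atoms"
    using f unfolding finite_combinations_def by blast
  have aL2: "a j \<in> L2" if "j < N" for j using a[OF that] local_h1_atoms_subset_L2 by blast
  have one: "(\<lambda>x. 1) \<in> (local_h1_atoms :: (real^'n \<Rightarrow> complex) set)"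
    by (simp add: local_h1_atoms_def H1_atoms_def)
  define nu where "nu j = (if j < N then lam j else 0)" for j
  define e where "e j = (if j < N then a j else (\<lambda>x. 1))" for j
  have pad: "(\<Sum>j<n. nu j * w (e j)) = (\<Sum>j<N. lam j * w (a j))" if "N \<le> n"
    for n and w :: "(real^'n \<Rightarrow> complex) \<Rightarrow> complex"
  proof -
    have "(\<Sum>j<n. nu j * w (e j)) = (\<Sum>j<N. nu j * w (e j))"
      using that by (intro sum.mono_neutral_right) (auto simp: nu_def)
    also have "\<dots> = (\<Sum>j<N. lam j * w (a j))" by (intro sum.cong) (auto simp: nu_def e_def)
    finally show ?thesis .
  qed
  have "f \<in> L2" unfolding f_eq by (rule L2_sum[OF aL2])
  then have L1: "f \<in> L1" "T f \<in> L1"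
    using L2_subset_L1 bounded_linear_operator_on_L2D(1)[OF T] by auto
  have "\<forall>\<^sub>F n in sequentially. L1_norm (\<lambda>x. f x - (\<Sum>j<n. nu j * e j x)) = 0"
    using eventually_ge_at_top[of N]
    by eventually_elim (simp add: pad[where w="\<lambda>h. h _"] f_eq L1_norm_def)
  moreover have "\<forall>\<^sub>F n in sequentially. L1_norm (\<lambda>x. T f x - (\<Sum>j<n. nu j * T (e j) x)) = 0"
    using eventually_ge_at_top[of N]
  proof eventually_elim
    case (elim n)
    have "(\<integral>x. cmod (T f x - (\<Sum>j<n. nu j * T (e j) x)) \<partial>gauss_measure) = 0"
    proof (rule integral_eq_zero_AE)
      show "AE x in gauss_measure. cmod (T f x - (\<Sum>j<n. nu j * T (e j) x)) = 0"
        using operator_finite_sum[OF T aL2, of N "\<lambda>j. j" lam]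
        unfolding f_eq pad[OF elim, where w="\<lambda>h. T h _"] by simp
    qed
    then show ?case by (simp add: L1_norm_def)
  qed
  moreover have "summable (\<lambda>j. cmod (nu j))"
    by (rule summable_finite[of "{..<N}"]) (auto simp: nu_def)
  moreover have "e j \<in> local_h1_atoms" for j using a one by (simp add: e_def)
  ultimately show ?thesis
    unfolding atomic_image_def atomic_decomposition_def using L1
    by (auto intro!: exI[of _ nu] exI[of _ e] tendsto_eventually)
qed

lemma bounded_local_h1_L1_if_bounded_on_atoms:
  fixes T :: "(real^'n \<Rightarrow> complex) \<Rightarrow> (real^'n \<Rightarrow> complex)"
  assumes T: "bounded_linear_operator_on_L2 T"
    and K: "\<And>a. a \<in> local_h1_atoms \<Longrightarrow> L1_norm (T a) \<le> K"
  shows "bounded_local_h1_L1 T"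
proof -
  let ?A = "local_h1_atoms :: (real^'n \<Rightarrow> complex) set"
  have AL1: "?A \<subseteq> L1" using local_h1_atoms_subset_L2 L2_subset_L1 by blast
  have TL1: "T a \<in> L1" if "a \<in> ?A" for a
    using that local_h1_atoms_subset_L2 L2_subset_L1 bounded_linear_operator_on_L2D(1)[OF T] by blast
  have unique: "AE x in gauss_measure. g x = h x"
    if "atomic_image T ?A f g" "atomic_image T ?A f h" for f g h
    using atomic_image_unique[OF T K that] by blast
  \<comment> \<open>Any choice of representative works: linearity, the norm bound and agreement with
    \<open>T\<close> are all insensitive to null sets.\<close>
  define S where "S f = (SOME g. atomic_image T ?A f g)" for f
  have S: "atomic_image T ?A f (S f)" if "atomic_image T ?A f g" for f g
    unfolding S_def by (rule someI[of "atomic_image T ?A f", OF that])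
  have S_space: "atomic_image T ?A f (S f)" if f: "f \<in> atomic_space ?A" for f
  proof -
    obtain lam a where "f \<in> L1" "atomic_decomposition ?A f lam a"
      using f unfolding atomic_space_def by blast
    then show ?thesis using atomic_image_exists[of ?A f lam a T K] TL1 K S by metis
  qed
  \<comment> \<open>All decompositions of \<open>f\<close> have the same image up to null sets, so
    each of them bounds the norm of \<open>S f\<close>, and the infimum may be taken. The constant
    \<open>\<bar>K\<bar> + 1\<close> is positive and can be divided by.\<close>
  have S_bound: "L1_norm (S f) \<le> (\<bar>K\<bar> + 1) * atomic_norm ?A f" if f: "f \<in> atomic_space ?A" for f
  proof -
    have "L1_norm (S f) / (\<bar>K\<bar> + 1) \<le> atomic_norm ?A f"
      unfolding atomic_norm_def
    proof (rule cInf_greatest)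
      show "{(\<Sum>j. cmod (lam j)) | lam a. atomic_decomposition ?A f lam a} \<noteq> {}"
        using f unfolding atomic_space_def by blast
      fix s assume "s \<in> {(\<Sum>j. cmod (lam j)) | lam a. atomic_decomposition ?A f lam a}"
      then obtain lam a where s: "s = (\<Sum>j. cmod (lam j))" and dec: "atomic_decomposition ?A f lam a"
        by blast
      have fL1: "f \<in> L1" using f by (simp add: atomic_space_def)
      obtain g where g: "atomic_image T ?A f g" "L1_norm g \<le> K * s"
        unfolding s using atomic_image_exists[of ?A f lam a T K, OF dec fL1 TL1 K] by blast
      have "L1_norm (S f) = L1_norm g"
        using S[OF g(1)] g(1) by (intro L1_norm_cong_AE unique) (auto simp: atomic_image_def)
      moreover have "0 \<le> s" unfolding s
        using dec by (intro suminf_nonneg) (auto simp: atomic_decomposition_def)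
      moreover have "K * s \<le> (\<bar>K\<bar> + 1) * s"
        using \<open>0 \<le> s\<close> by (intro mult_right_mono) auto
      ultimately show "L1_norm (S f) / (\<bar>K\<bar> + 1) \<le> s"
        using g(2) by (simp add: pos_divide_le_eq mult.commute)
    qed
    then show ?thesis by (simp add: pos_divide_le_eq mult.commute)
  qed
  show ?thesis
    unfolding bounded_to_L1_def
  proof (intro exI[of _ S] conjI ballI allI)
    show "S f \<in> L1" if "f \<in> atomic_space ?A" for f
      using S_space[OF that] by (simp add: atomic_image_def)
    show "AE x in gauss_measure. S (\<lambda>z. \<alpha> * f z + \<beta> * g z) x = \<alpha> * S f x + \<beta> * S g x"
      if "f \<in> atomic_space ?A" "g \<in> atomic_space ?A" for f g \<alpha> \<beta>
    proof -
      have lin: "atomic_image T ?A (\<lambda>z. \<alpha> * f z + \<beta> * g z) (\<lambda>x. \<alpha> * S f x + \<beta> * S g x)"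
        by (rule atomic_image_linear[OF S_space[OF that(1)] S_space[OF that(2)] AL1 TL1])
      show ?thesis by (rule unique[OF S[OF lin] lin])
    qed
    show "\<exists>C. \<forall>f\<in>atomic_space ?A. L1_norm (S f) \<le> C * atomic_norm ?A f"
      using S_bound by blast
    show "AE x in gauss_measure. S f x = T f x" if "f \<in> finite_combinations ?A" for f
      using atomic_image_finite_combination[OF T that] by (intro unique[OF S])
  qed
qed

subsection \<open>The main result\<close>

lemma local_Hormander_const_ge:
  assumes "admissible c r" "y \<in> ball c r" "z \<in> ball c r"
  shows "(\<integral>\<^sup>+x\<in>- ball c (2 * r). ennreal (cmod (k x y - k x z)) \<partial>gauss_measure) \<le> local_Hormander_const k"
  unfolding local_Hormander_const_def
proof (rule SUP_upper2[of "(c, r)"], goal_cases)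
  case 2
  then show ?case
    unfolding prod.case by (rule SUP_upper2[OF assms(2)], rule SUP_upper2[OF assms(3)]) simp
qed (use assms in simp)

text \<open>For x off 2B_y, |k(x, y)| is at most the mean over z in B_y of |k(x, y) - k(x, z)| plus
  |T a x|, with \<open>a\<close> the normalised indicator of B_y. Integrating in x and exchanging
  the order of integration bounds the first part by the Hoermander constant, as B_y is
  admissible.\<close>

lemma I_infinity_bound_at_point:
  fixes k :: "real^'n \<Rightarrow> real^'n \<Rightarrow> complex"
  assumes T: "bounded_linear_operator_on_L2 T" and k: "is_kernel_of k T"
    and K: "\<And>a. a \<in> global_atoms \<Longrightarrow> L1_norm (T a) \<le> K"
  shows "(\<integral>\<^sup>+x\<in>- ball y (2 * max_radius y). ennreal (cmod (k x y)) \<partial>gauss_measure) \<le>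
         local_Hormander_const k + ennreal K"
proof -
  let ?\<gamma> = "gauss_measure :: (real^'n) measure"
  let ?B = "ball y (max_radius y)" and ?E = "- ball y (2 * max_radius y)"
  let ?g = "measure ?\<gamma> ?B"
  note r = max_radius_pos[of y]
  have pos: "0 < ?g" by (rule measure_ball_pos[OF r])
  have em: "emeasure ?\<gamma> ?B = ennreal ?g" by (rule gauss.emeasure_eq_measure)
  have yB: "y \<in> ?B" using r by simp
  define kk where "kk = (\<lambda>(x, z). if x = z then 0 else k x z)"
  have kk[measurable]: "kk \<in> borel_measurable (?\<gamma> \<Otimes>\<^sub>M ?\<gamma>)"
    using k kernel_measurable unfolding is_kernel_of_def kk_def by blast
  have off: "x \<noteq> z" if "x \<in> ?E" "z \<in> ?B" for x z
    using that r by auto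
  \<comment> \<open>Normalised to integral 1, so that T a is a genuine mean of the kernel; its L^2
    norm is then exactly the one allowed for a global atom.\<close>
  define a :: "real^'n \<Rightarrow> complex" where "a x = of_real (1 / ?g) * indicator ?B x" for x
  have [measurable]: "?B \<in> sets borel" "?E \<in> sets borel" by auto
  have am: "a \<in> borel_measurable borel" unfolding a_def[abs_def] by measurable
  have asq: "square_integrable ?\<gamma> a"
    by (rule gauss.square_integrable_bounded[of _ "1 / ?g"])
       (use am pos in \<open>auto simp: a_def indicator_def norm_divide\<close>)
  have "(\<integral>z. a z \<partial>?\<gamma>) = (\<integral>z. indicat_real ?B z *\<^sub>R complex_of_real (1 / ?g) \<partial>?\<gamma>)"
    by (intro Bochner_Integration.integral_cong) (auto simp: a_def indicator_def)
  also have "\<dots> = 1"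
    using pos by (subst integral_scaleR_left) (simp_all add: em scaleR_conv_of_real)
  finally have a_mean: "(\<integral>z. a z \<partial>?\<gamma>) = 1" .
  have "L2_norm a = 1 / ?g * sqrt ?g"
    unfolding L2_norm_eq a_def[abs_def] norm2_cmult norm2_indicator using pos by (simp add: norm_divide)
  also have "\<dots> = ?g powr (- 1 / 2)"
    unfolding powr_minus_half[OF pos] using pos by (simp add: field_simps real_sqrt_mult_self)
  finally have "a \<in> global_atoms"
    unfolding global_atoms_def using asq
    by (intro CollectI conjI exI[of _ y]) (auto simp: L2_iff supported_in_def a_def)
  then have TaK: "L1_norm (T a) \<le> K" by (rule K)
  have supp_sub: "support a \<subseteq> cball y (max_radius y)"
    unfolding support_def by (intro closure_minimal) (auto simp: a_def indicator_def split: if_splits)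
  have "bounded (range a)"
    by (rule boundedI[of _ "1 / ?g"]) (use pos in \<open>auto simp: a_def indicator_def norm_divide\<close>)
  moreover have "compact (support a)"
    using supp_sub compact_Int_closed[OF compact_cball, of "support a" y "max_radius y"]
    by (simp add: support_def Int_absorb1)
  ultimately have AE: "AE x in ?\<gamma>. x \<notin> support a \<longrightarrow> T a x = (\<integral>z. k x z * a z \<partial>?\<gamma>)"
    using k am unfolding is_kernel_of_def by blast
  have Ta: "T a \<in> L1"
    using asq bounded_linear_operator_on_L2D(1)[OF T] by (intro L2_subset_L1) (simp add: L2_iff)
  have [measurable]: "T a \<in> borel_measurable borel" using Ta by (auto simp: L1_def)
  let ?D = "\<lambda>x z. indicator ?E x * (ennreal (1 / ?g) * (ennreal (cmod (kk (x, y) - kk (x, z))) * indicator ?B z))"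
  have "(\<integral>\<^sup>+x\<in>?E. ennreal (cmod (k x y)) \<partial>?\<gamma>) \<le>
        (\<integral>\<^sup>+x. (\<integral>\<^sup>+z. ?D x z \<partial>?\<gamma>) + ennreal (cmod (T a x)) \<partial>?\<gamma>)"
  proof (rule nn_integral_mono_AE, use AE in eventually_elim)
    case (elim x)
    show ?case
    proof (cases "x \<in> ?E")
      case True
      then have "x \<notin> cball y (max_radius y)" using r by auto
      then have Tax: "T a x = (\<integral>z. k x z * a z \<partial>?\<gamma>)" using elim supp_sub by blast
      define h where "h z = (kk (x, y) - kk (x, z)) * a z" for z
      have hm: "h \<in> borel_measurable ?\<gamma>" unfolding h_def[abs_def] using am by simp
      have h_norm: "(\<integral>\<^sup>+z. ennreal (cmod (h z)) \<partial>?\<gamma>) = (\<integral>\<^sup>+z. ?D x z \<partial>?\<gamma>)"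
      proof (rule nn_integral_cong)
        fix z
        have "cmod (h z) = indicator ?E x * (1 / ?g * (cmod (kk (x, y) - kk (x, z)) * indicator ?B z))"
          using True pos by (simp add: h_def a_def norm_mult norm_divide indicator_def)
        then show "ennreal (cmod (h z)) = ?D x z"
          using True pos by (simp add: ennreal_mult[symmetric] indicator_def)
      qed
      have "ennreal (cmod (k x y)) \<le> (\<integral>\<^sup>+z. ennreal (cmod (h z)) \<partial>?\<gamma>) + ennreal (cmod (T a x))"
      proof (cases "integrable ?\<gamma> h")
        case int: True
        have "T a x = (\<integral>z. kk (x, z) * a z \<partial>?\<gamma>)"
          unfolding Tax using off[OF True]
          by (intro Bochner_Integration.integral_cong) (auto simp: kk_def a_def indicator_def)
        also have "\<dots> = (\<integral>z. kk (x, y) * a z - h z \<partial>?\<gamma>)"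
          by (simp add: h_def algebra_simps)
        also have "\<dots> = kk (x, y) - (\<integral>z. h z \<partial>?\<gamma>)"
          using int gauss.integrable_square_integrable[OF asq] by (simp add: a_mean)
        finally have "k x y = (\<integral>z. h z \<partial>?\<gamma>) + T a x"
          using off[OF True yB] by (simp add: kk_def)
        then have "ennreal (cmod (k x y)) \<le> ennreal (cmod (\<integral>z. h z \<partial>?\<gamma>)) + ennreal (cmod (T a x))"
          by (simp add: norm_triangle_ineq flip: ennreal_plus)
        then show ?thesis
          using norm_integral_le_nn_integral[of ?\<gamma> h] by (meson add_right_mono order_trans)
      next
        \<comment> \<open>If \<open>h\<close> is not integrable, the integral of its modulus is
          infinite and the inequality is trivial.\<close>
        case False
        then show ?thesis
          using hm by (simp add: integrable_iff_bounded less_top[symmetric])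
      qed
      then show ?thesis using True unfolding h_norm by simp
    qed simp
  qed
  also have "\<dots> = (\<integral>\<^sup>+x. (\<integral>\<^sup>+z. ?D x z \<partial>?\<gamma>) \<partial>?\<gamma>) + (\<integral>\<^sup>+x. ennreal (cmod (T a x)) \<partial>?\<gamma>)"
    by (rule nn_integral_add) measurable
  also have "\<dots> \<le> local_Hormander_const k + ennreal K"
  proof (rule add_mono)
    have "(\<integral>\<^sup>+x. (\<integral>\<^sup>+z. ?D x z \<partial>?\<gamma>) \<partial>?\<gamma>) = (\<integral>\<^sup>+z. (\<integral>\<^sup>+x. ?D x z \<partial>?\<gamma>) \<partial>?\<gamma>)"
      by (rule gauss_pair.Fubini'[symmetric]) measurable
    also have "\<dots> \<le> (\<integral>\<^sup>+z. local_Hormander_const k * ennreal (1 / ?g) * indicator ?B z \<partial>?\<gamma>)"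
    proof (rule nn_integral_mono)
      fix z
      show "(\<integral>\<^sup>+x. ?D x z \<partial>?\<gamma>) \<le> local_Hormander_const k * ennreal (1 / ?g) * indicator ?B z"
      proof (cases "z \<in> ?B")
        case True
        have "(\<integral>\<^sup>+x. ?D x z \<partial>?\<gamma>) =
            (\<integral>\<^sup>+x. (ennreal (cmod (kk (x, y) - kk (x, z))) * indicator ?E x) * ennreal (1 / ?g) \<partial>?\<gamma>)"
          using True by (intro nn_integral_cong) (simp add: mult_ac)
        also have "\<dots> = (\<integral>\<^sup>+x. ennreal (cmod (kk (x, y) - kk (x, z))) * indicator ?E x \<partial>?\<gamma>) * ennreal (1 / ?g)"
          by (rule nn_integral_multc) measurable
        also have "\<dots> \<le> local_Hormander_const k * ennreal (1 / ?g)"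
        proof (rule mult_right_mono)
          have "(\<integral>\<^sup>+x. ennreal (cmod (kk (x, y) - kk (x, z))) * indicator ?E x \<partial>?\<gamma>) =
              (\<integral>\<^sup>+x\<in>?E. ennreal (cmod (k x y - k x z)) \<partial>?\<gamma>)"
            using off yB True by (intro nn_integral_cong) (auto simp: kk_def indicator_def)
          also have "\<dots> \<le> local_Hormander_const k"
            by (rule local_Hormander_const_ge[OF _ yB True]) (simp add: admissible_def r)
          finally show "(\<integral>\<^sup>+x. ennreal (cmod (kk (x, y) - kk (x, z))) * indicator ?E x \<partial>?\<gamma>) \<le>
              local_Hormander_const k" .
        qed simp
        finally show ?thesis using True by simp
      qed simp
    qed
    also have "\<dots> = local_Hormander_const k * (ennreal (1 / ?g) * ennreal ?g)"
      by (subst nn_integral_cmult_indicator) (simp_all add: em mult.assoc)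
    also have "ennreal (1 / ?g) * ennreal ?g = 1"
      using pos by (simp flip: ennreal_mult)
    finally show "(\<integral>\<^sup>+x. (\<integral>\<^sup>+z. ?D x z \<partial>?\<gamma>) \<partial>?\<gamma>) \<le> local_Hormander_const k" by simp
    have "(\<integral>\<^sup>+x. ennreal (cmod (T a x)) \<partial>?\<gamma>) = ennreal (L1_norm (T a))"
      unfolding L1_norm_def using Ta by (intro nn_integral_eq_integral) (auto simp: L1_def)
    then show "(\<integral>\<^sup>+x. ennreal (cmod (T a x)) \<partial>?\<gamma>) \<le> ennreal K"
      using TaK by (simp add: ennreal_leI)
  qed
  finally show ?thesis .
qed

theorem proposition3p3:
  fixes T :: "(real^'n \<Rightarrow> complex) \<Rightarrow> (real^'n \<Rightarrow> complex)"
    and k :: "real^'n \<Rightarrow> real^'n \<Rightarrow> complex"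
  assumes "bounded_linear_operator_on_L2 T"
    and "is_kernel_of k T"
  shows "(bounded_local_h1_L1 T \<and> local_Hormander_const k < \<infinity> \<longrightarrow> I_infinity k < \<infinity>) \<and>
         (bounded_H1_L1 T \<and> I_infinity k < \<infinity> \<longrightarrow> bounded_local_h1_L1 T)"
proof (intro conjI impI; elim conjE)
  note TL2 = bounded_linear_operator_on_L2D(1)[OF assms(1)]
  {
    assume "bounded_local_h1_L1 T" and H: "local_Hormander_const k < \<infinity>"
    then obtain K where K: "\<And>a. a \<in> local_h1_atoms \<Longrightarrow> L1_norm (T a) \<le> K"
      using bounded_to_L1_atoms[of local_h1_atoms T, OF _ local_h1_atoms_subset_L2 TL2] by blast
    have "I_infinity k \<le> local_Hormander_const k + ennreal K"
      unfolding I_infinity_def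
      by (intro SUP_least I_infinity_bound_at_point[OF assms] K) (simp add: local_h1_atoms_def)
    also have "\<dots> < \<infinity>" using H by (simp add: ennreal_add_less_top)
    finally show "I_infinity k < \<infinity>" .
  next
    assume "bounded_H1_L1 T" and I: "I_infinity k < \<infinity>"
    then obtain K where K: "\<And>a. a \<in> H1_atoms \<Longrightarrow> L1_norm (T a) \<le> K"
      using bounded_to_L1_atoms[of H1_atoms T, OF _ H1_atoms_subset_L2 TL2] by blast
    obtain K' where K': "\<And>a. a \<in> global_atoms \<Longrightarrow> L1_norm (T a) \<le> K'"
      using global_atom_bound[of T k, OF assms I] by blast
    show "bounded_local_h1_L1 T"
    proof (rule bounded_local_h1_L1_if_bounded_on_atoms[OF assms(1)])
      fix a :: "real^'n \<Rightarrow> complex"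
      assume "a \<in> local_h1_atoms"
      then show "L1_norm (T a) \<le> max K K'"
        using K K' by (auto simp: local_h1_atoms_def le_max_iff_disj)
    qed
  }
qed

end
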